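(* Let $\mu\in\mathbb{C}^*$. The left ideal $\mathcal{I}_\mu$ of $D_N$ is the left ideal of germs of partial differential operators (in the variables $\sigma$) annihilating each function $\sigma\mapsto\big(a^k/P_\sigma(a)\big)^\mu$ when $|a|$ is large enough. So $\mathcal{I}_\mu$ is the left ideal in $D_N$ of germs of partial differential operators killing each polynomial $\Phi_{\mu,q}\in\mathbb{C}[\sigma_1,\dots,\sigma_k]$ for $q\in\mathbb{N}$.
   Context: Let $k\ge 2$ be an integer and $N=\mathbb{C}^k$ with coordinates $\sigma_1,\dots,\sigma_k$, $\partial_h=\partial/\partial\sigma_h$; $D_N$ is the sheaf of holomorphic differential operators on $N$. Intervals $[p,q]$ are intervals of integers; $\mathbb{N}=\{0,1,2,\dots\}$; $\mathbb{C}^*=\mathbb{C}\setminus\{0\}$. Put $E=\sum_{h=1}^k\sigma_h\partial_h$. $\mathcal{I}_\mu$ is the left ideal of $D_N$ generated by $A_{p,q}=\partial_p\partial_q-\partial_{p+1}\partial_{q-1}$ ($p\in[1,k-1]$, $q\in[2,k]$) and $\mathcal{T}^m_\mu=\partial_1\partial_{m-1}+\partial_m(E+\mu)$ ($m\in[2,k]$). $P_\sigma(a)=a^k+\sum_{h=1}^k(-1)^h\sigma_ha^{k-h}$. For $|a|$ large compared with $\sigma$, $(a^k/P_\sigma(a))^\mu:=\exp(\mu\,\mathrm{Log}(a^k/P_\sigma(a)))$ with the branch of $\mathrm{Log}$ vanishing at $a=\infty$. The polynomial $\Phi_{\mu,q}$ is the weight $q$ part ($\sigma_h$ having weight $h$)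 of the Taylor expansion at $\sigma=0$ of $(1+\sum_{h=1}^k(-1)^h\sigma_h)^{-\mu}$; equivalently, the $\Phi_{\mu,q}$ are the coefficients of the Laurent expansion at infinity $(a^k/P_\sigma(a))^\mu=\sum_{q\ge0}\Phi_{\mu,q}(\sigma)a^{-q}$.
   Formalization: The ideal equals the annihilators only for μ not a negative integer; the claim fails otherwise (k=2, μ=-1: ∂_1² kills every function but is not in the ideal). For negative integers μ only the inclusion of the ideal and the equality of the two annihilators are stated. *)

theory Defs
  imports "HOL-Analysis.Analysis"
begin

text \<open>
  The manifold N is \<^typ>\<open>complex ^ 'k\<close>, with k = CARD('k). The coordinates are numbered by
  1, ..., k through an arbitrary enumeration of the index type, fixed once and for all.
\<close>

definition coord_index :: "nat \<Rightarrow> 'k::finite" where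
  "coord_index = (SOME e. bij_betw e {1..CARD('k)} UNIV)"

definition coord :: "complex ^ 'k \<Rightarrow> nat \<Rightarrow> complex" where
  "coord \<sigma> h = \<sigma> $ coord_index h"

definition pd :: "nat \<Rightarrow> (complex ^ 'k \<Rightarrow> complex) \<Rightarrow> complex ^ 'k \<Rightarrow> complex" where
  "pd h f \<sigma> = deriv (\<lambda>t. f (\<sigma> + axis (coord_index h) t)) 0"

definition multi_indices :: "nat \<Rightarrow> (nat \<Rightarrow> nat) set" where
  "multi_indices k = {\<alpha>. \<forall>h. h \<notin> {1..k} \<longrightarrow> \<alpha> h = 0}"

definition pd_multi :: "(nat \<Rightarrow> nat) \<Rightarrow> (complex ^ 'k \<Rightarrow> complex) \<Rightarrow> complex ^ 'k \<Rightarrow> complex" where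
  "pd_multi \<alpha> = foldr (\<lambda>h D. (pd h ^^ \<alpha> h) \<circ> D) [1..<Suc CARD('k)] id"

definition holo_on :: "(complex ^ 'k) set \<Rightarrow> (complex ^ 'k \<Rightarrow> complex) \<Rightarrow> bool" where
  "holo_on U f \<longleftrightarrow>
     (\<forall>\<sigma>\<in>U. \<exists>L. (f has_derivative L) (at \<sigma>) \<and> (\<forall>c v. L (c *s v) = c * L v))"

text \<open>
  Germs at a point x are handled through representatives: functions and operators are total, only
  their behaviour near x matters, and every set of operators below is closed under equality of
  germs at x. Two operators have the same germ at x if they induce the same endomorphism of the
  sheaf of holomorphic functions on a neighbourhood of x. Operators are equal in the stalk at x
  of the sheaf of differential operators iff they are related in this way, since that sheaf acts
  faithfully on holomorphic functions.
\<close>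

type_synonym 'k operator = "(complex ^ 'k \<Rightarrow> complex) \<Rightarrow> complex ^ 'k \<Rightarrow> complex"

definition holo_germs :: "complex ^ 'k \<Rightarrow> (complex ^ 'k \<Rightarrow> complex) set" where
  "holo_germs x = {f. \<exists>U. open U \<and> x \<in> U \<and> holo_on U f}"

definition same_germ :: "complex ^ 'k \<Rightarrow> 'k operator \<Rightarrow> 'k operator \<Rightarrow> bool" where
  "same_germ x P Q \<longleftrightarrow>
     (\<exists>U. open U \<and> x \<in> U \<and>
        (\<forall>V f. open V \<and> V \<subseteq> U \<and> holo_on V f \<longrightarrow> (\<forall>\<sigma>\<in>V. P f \<sigma> = Q f \<sigma>)))"

definition diffop_germs :: "complex ^ 'k \<Rightarrow> 'k operator set" where
  "diffop_germs x =
     {P. \<exists>A c. finite A \<and> A \<subseteq> multi_indices CARD('k) \<and> (\<forall>\<alpha>\<in>A. c \<alpha> \<in> holo_germs x) \<and>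
           same_germ x P (\<lambda>f \<sigma>. \<Sum>\<alpha>\<in>A. c \<alpha> \<sigma> * pd_multi \<alpha> f \<sigma>)}"

definition euler_op :: "'k::finite operator" where
  "euler_op f \<sigma> = (\<Sum>h=1..CARD('k). coord \<sigma> h * pd h f \<sigma>)"

definition A_op :: "nat \<Rightarrow> nat \<Rightarrow> 'k::finite operator" where
  "A_op p q f \<sigma> = pd p (pd q f) \<sigma> - pd (p + 1) (pd (q - 1) f) \<sigma>"

definition T_op :: "complex \<Rightarrow> nat \<Rightarrow> 'k::finite operator" where
  "T_op \<mu> m f \<sigma> = pd 1 (pd (m - 1) f) \<sigma> + pd m (\<lambda>\<tau>. euler_op f \<tau> + \<mu> * f \<tau>) \<sigma>"

text \<open>The stalk at x of the left ideal generated by the operators \<^const>\<open>A_op\<close> and \<^const>\<open>T_op\<close>.\<close>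

definition ideal_germs :: "complex \<Rightarrow> complex ^ 'k \<Rightarrow> 'k operator set" where
  "ideal_germs \<mu> x =
     {P \<in> diffop_germs x. \<exists>Q R.
        (\<forall>p\<in>{1..CARD('k) - 1}. \<forall>q\<in>{2..CARD('k)}. Q p q \<in> diffop_germs x) \<and>
        (\<forall>m\<in>{2..CARD('k)}. R m \<in> diffop_germs x) \<and>
        same_germ x P (\<lambda>f \<sigma>.
          (\<Sum>p=1..CARD('k) - 1. \<Sum>q=2..CARD('k). Q p q (A_op p q f) \<sigma>) +
          (\<Sum>m=2..CARD('k). R m (T_op \<mu> m f) \<sigma>))}"

definition P_poly :: "complex ^ 'k \<Rightarrow> complex \<Rightarrow> complex" where
  "P_poly \<sigma> a = a ^ CARD('k) + (\<Sum>h=1..CARD('k). (-1) ^ h * coord \<sigma> h * a ^ (CARD('k) - h))"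

text \<open>
  If the sum of the moduli of coord \<sigma> h / a ^ h is less than 1, then P_poly \<sigma> a / a ^ k lies in the
  disc of radius 1 around 1, so on this domain the principal branch \<^const>\<open>Ln\<close> is the continuous
  branch of the logarithm that vanishes at infinity.
\<close>

definition F_fun :: "complex \<Rightarrow> complex \<Rightarrow> complex ^ 'k \<Rightarrow> complex" where
  "F_fun \<mu> a \<sigma> = exp (\<mu> * Ln (a ^ CARD('k) / P_poly \<sigma> a))"

definition Phi_gen :: "complex \<Rightarrow> complex ^ 'k \<Rightarrow> complex" where
  "Phi_gen \<mu> \<sigma> = (1 + (\<Sum>h=1..CARD('k). (-1) ^ h * coord \<sigma> h)) powr (- \<mu>)"

definition weight_indices :: "nat \<Rightarrow> nat \<Rightarrow> (nat \<Rightarrow> nat) set" where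
  "weight_indices k q = {\<alpha> \<in> multi_indices k. (\<Sum>h=1..k. h * \<alpha> h) = q}"

definition Phi :: "complex \<Rightarrow> nat \<Rightarrow> complex ^ 'k \<Rightarrow> complex" where
  "Phi \<mu> q \<sigma> =
     (\<Sum>\<alpha>\<in>weight_indices CARD('k) q.
        pd_multi \<alpha> (Phi_gen \<mu> :: complex ^ 'k \<Rightarrow> complex) 0 / (\<Prod>h=1..CARD('k). fact (\<alpha> h))
          * (\<Prod>h=1..CARD('k). coord \<sigma> h ^ \<alpha> h))"

definition kills :: "complex ^ 'k \<Rightarrow> 'k operator \<Rightarrow> (complex ^ 'k \<Rightarrow> complex) \<Rightarrow> bool" where
  "kills x P f \<longleftrightarrow> eventually (\<lambda>\<sigma>. P f \<sigma> = 0) (nhds x)"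

definition ann_F :: "complex \<Rightarrow> complex ^ 'k \<Rightarrow> 'k operator set" where
  "ann_F \<mu> x = {P \<in> diffop_germs x. \<exists>r. \<forall>a. cmod a > r \<longrightarrow> kills x P (F_fun \<mu> a)}"

definition ann_Phi :: "complex \<Rightarrow> complex ^ 'k \<Rightarrow> 'k operator set" where
  "ann_Phi \<mu> x = {P \<in> diffop_germs x. \<forall>q. kills x P (Phi \<mu> q)}"

text \<open>
  Equality of these annihilators with the ideal requires \<mu> not to be a negative integer: for
  \<mu> = -n the functions \<^term>\<open>F_fun \<mu> a\<close> are polynomials in \<sigma> of degree n, and the annihilator is
  strictly larger than the ideal. For instance, for k = 2 and \<mu> = -1 the second derivative in the
  first coordinate annihilates all of them, but it is not in the ideal, since it does not kill the
  polynomial coord \<sigma> 1 * coord \<sigma> 2 - coord \<sigma> 1 ^ 3 / 6, which the ideal kills.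
\<close>

end

theory Submission
  imports Defs "HOL-Complex_Analysis.Complex_Analysis"
begin

text \<open>
  Put \<open>s = 1 / a\<close> and let \<open>u\<close> be \<open>1 + (\<Sum>h. (-1)^h * \<sigma>_h * s^h)\<close>, so that the functions in
  question are \<open>u powr (- \<mu>)\<close> and the polynomials \<open>Phi \<mu> q\<close> are its coefficients in \<open>s\<close>. A
  derivative of order \<open>n\<close> and weight \<open>w\<close> (the sum of the \<open>n\<close> indices) maps \<open>u powr (- \<mu>)\<close> to
  \<open>(-1)^(n+w) * pochhammer \<mu> n * s^w * u powr (- \<mu> - n)\<close>. Hence an operator of order at most \<open>N\<close>
  maps it to \<open>u powr (- \<mu> - N)\<close> times a polynomial in \<open>s\<close> of degree at most \<open>k * N\<close>, the symbol
  of the operator. Killing all the functions and killing all the polynomials both mean that the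
  symbol vanishes near the base point.

  Modulo the operators \<open>A\<close>, a derivative depends only on its order and weight. Multiplying \<open>T\<close> by
  derivatives expresses \<open>\<mu> + n\<close> times the derivative of order \<open>n\<close> and weight \<open>j > n\<close> through
  derivatives of order \<open>n + 1\<close>. So if \<open>\<mu>\<close> is not a nonpositive integer, every operator of order at
  most \<open>N\<close> is congruent modulo the ideal to a combination of one derivative for each weight
  \<open>j \<le> k * N\<close>, of order \<open>min j N\<close>. The symbol of that derivative is a nonzero constant times
  \<open>s^j * u^(N - min j N)\<close>; these are triangular in \<open>s\<close>, so the combination vanishes as soon as it
  kills the functions.
\<close>

section \<open>Several complex variables\<close>

lemma bij_betw_coord_index:
  "bij_betw (coord_index :: nat \<Rightarrow> 'k::finite) {1..CARD('k)} UNIV"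
proof -
  have "\<exists>e :: nat \<Rightarrow> 'k. bij_betw e {1..CARD('k)} UNIV"
    using ex_bij_betw_nat_finite_1[of "UNIV :: 'k set"] by simp
  then show ?thesis unfolding coord_index_def by (rule someI_ex)
qed

lemma coord_index_eq_iff:
  assumes "h \<in> {1..CARD('k)}" "m \<in> {1..CARD('k)}"
  shows "(coord_index h :: 'k::finite) = coord_index m \<longleftrightarrow> h = m"
  using bij_betw_coord_index assms by (metis bij_betw_def inj_onD)

lemma axis_eq_vector_scalar: "axis i (t::complex) = t *s axis i 1"
  by (simp add: vec_eq_iff axis_def)

lemma bounded_linear_axis: "bounded_linear (axis i :: complex \<Rightarrow> complex ^ 'k)"
proof -
  have "linear (axis i :: complex \<Rightarrow> complex ^ 'k)"
    by (rule linearI) (auto simp: vec_eq_iff axis_def)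
  then show ?thesis by (simp add: linear_conv_bounded_linear)
qed

lemma norm_axis_complex [simp]: "norm (axis i (t::complex)) = norm t"
  by (simp add: norm_vec_def L2_set_def axis_def if_distrib if_distribR cong: if_cong)

text \<open>Homogeneity over the complex numbers turns the real derivative \<open>L\<close>,
  restricted to a coordinate line, into multiplication by the number
  \<open>L (axis i 1)\<close>.\<close>

lemma has_field_derivative_along_axis:
  fixes f :: "complex ^ 'k \<Rightarrow> complex"
  assumes "(f has_derivative L) (at (\<sigma> + axis i t))" and "\<And>c v. L (c *s v) = c * L v"
  shows "((\<lambda>t. f (\<sigma> + axis i t)) has_field_derivative L (axis i 1)) (at t)"
proof -
  have "((\<lambda>t. \<sigma> + axis i t) has_derivative axis i) (at t)"
    by (auto intro!: derivative_eq_intros bounded_linear_imp_has_derivative bounded_linear_axis)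
  from has_derivative_compose[OF this assms(1)]
  have "((\<lambda>t. f (\<sigma> + axis i t)) has_derivative (\<lambda>t. L (axis i t))) (at t)" .
  moreover have "(\<lambda>t. L (axis i t)) = (*) (L (axis i 1))"
    by (subst axis_eq_vector_scalar) (simp add: assms(2) mult.commute fun_eq_iff)
  ultimately show ?thesis by (simp add: has_field_derivative_def)
qed

text \<open>The rules for sums, products and compositions below are read off from total derivatives
  through this evaluation on an axis.\<close>

lemma pd_eqI:
  assumes "(f has_derivative L) (at \<sigma>)" and "\<And>c v. L (c *s v) = c * L v"
  shows "pd h f \<sigma> = L (axis (coord_index h) 1)"
  unfolding pd_def using has_field_derivative_along_axis[of f L \<sigma> _ 0] assms
  by (intro DERIV_imp_deriv) (auto simp: axis_def zero_vec_def[symmetric])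

lemma holo_onE:
  assumes "holo_on U f" "\<sigma> \<in> U"
  obtains L where "(f has_derivative L) (at \<sigma>)" "\<And>c v. L (c *s v) = c * L v"
  using assms unfolding holo_on_def by blast

lemma holo_onI:
  assumes "\<And>\<sigma>. \<sigma> \<in> U \<Longrightarrow> \<exists>L. (f has_derivative L) (at \<sigma>) \<and> (\<forall>c v. L (c *s v) = c * L v)"
  shows "holo_on U f"
  using assms unfolding holo_on_def by blast

lemma holo_on_subset: "holo_on U f \<Longrightarrow> V \<subseteq> U \<Longrightarrow> holo_on V f"
  unfolding holo_on_def by blast

lemma holo_on_continuous_on: "holo_on U f \<Longrightarrow> continuous_on U f"
  unfolding holo_on_def
  by (meson continuous_at_imp_continuous_on has_derivative_continuous)

lemma holo_on_cong:
  assumes "open U" "holo_on U f" "\<And>\<sigma>. \<sigma> \<in> U \<Longrightarrow> g \<sigma> = f \<sigma>"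
  shows "holo_on U g"
proof (rule holo_onI)
  fix \<sigma> assume \<sigma>: "\<sigma> \<in> U"
  with assms(2) obtain L where L: "(f has_derivative L) (at \<sigma>)" "\<And>c v. L (c *s v) = c * L v"
    by (metis holo_onE)
  have "(g has_derivative L) (at \<sigma>)"
    using has_derivative_transform_within_open[OF L(1) assms(1) \<sigma>] assms(3) by simp
  with L(2) show "\<exists>L. (g has_derivative L) (at \<sigma>) \<and> (\<forall>c v. L (c *s v) = c * L v)" by blast
qed

lemma holo_on_const [intro!]: "holo_on U (\<lambda>_. c)"
  by (rule holo_onI, rule exI[of _ "\<lambda>_. 0"]) simp

lemma holo_on_coord [intro!]: "holo_on U (\<lambda>\<sigma>. coord \<sigma> h)"
proof (rule holo_onI, rule exI[of _ "\<lambda>v. v $ coord_index h"], safe)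
  fix \<sigma> :: "complex ^ 'k"
  show "((\<lambda>\<sigma>. coord \<sigma> h) has_derivative (\<lambda>v. v $ coord_index h)) (at \<sigma>)"
    unfolding coord_def by (intro bounded_linear_imp_has_derivative bounded_linear_vec_nth)
qed simp

lemma holo_on_add [intro!]:
  assumes "holo_on U f" "holo_on U g" shows "holo_on U (\<lambda>\<sigma>. f \<sigma> + g \<sigma>)"
proof (rule holo_onI)
  fix \<sigma> assume "\<sigma> \<in> U"
  with assms obtain L M where "(f has_derivative L) (at \<sigma>)" "\<And>c v. L (c *s v) = c * L v"
     "(g has_derivative M) (at \<sigma>)" "\<And>c v. M (c *s v) = c * M v" by (metis holo_onE)
  then show "\<exists>L. ((\<lambda>\<sigma>. f \<sigma> + g \<sigma>) has_derivative L) (at \<sigma>) \<and> (\<forall>c v. L (c *s v) = c * L v)"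
    by (intro exI[of _ "\<lambda>v. L v + M v"]) (auto intro!: derivative_intros simp: algebra_simps)
qed

lemma holo_on_mult [intro!]:
  assumes "holo_on U f" "holo_on U g" shows "holo_on U (\<lambda>\<sigma>. f \<sigma> * g \<sigma>)"
proof (rule holo_onI)
  fix \<sigma> assume "\<sigma> \<in> U"
  with assms obtain L M where "(f has_derivative L) (at \<sigma>)" "\<And>c v. L (c *s v) = c * L v"
     "(g has_derivative M) (at \<sigma>)" "\<And>c v. M (c *s v) = c * M v" by (metis holo_onE)
  then show "\<exists>L. ((\<lambda>\<sigma>. f \<sigma> * g \<sigma>) has_derivative L) (at \<sigma>) \<and> (\<forall>c v. L (c *s v) = c * L v)"
    by (intro exI[of _ "\<lambda>v. f \<sigma> * M v + L v * g \<sigma>"])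
       (simp add: has_derivative_mult distrib_left mult.assoc mult.left_commute)
qed

lemma holo_on_minus [intro!]: "holo_on U f \<Longrightarrow> holo_on U (\<lambda>\<sigma>. - f \<sigma>)"
  using holo_on_mult[OF holo_on_const[of U "-1"]] by simp

lemma holo_on_sum [intro!]:
  "(\<And>i. i \<in> I \<Longrightarrow> holo_on U (f i)) \<Longrightarrow> holo_on U (\<lambda>\<sigma>. \<Sum>i\<in>I. f i \<sigma>)"
  by (induction I rule: infinite_finite_induct) auto

lemma holo_on_power [intro!]: "holo_on U f \<Longrightarrow> holo_on U (\<lambda>\<sigma>. f \<sigma> ^ n)"
  by (induction n) auto

lemma holo_on_prod [intro!]:
  "(\<And>i. i \<in> I \<Longrightarrow> holo_on U (f i)) \<Longrightarrow> holo_on U (\<lambda>\<sigma>. \<Prod>i\<in>I. f i \<sigma>)"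
  by (induction I rule: infinite_finite_induct) auto

lemma pd_const [simp]: "pd h (\<lambda>_. c) \<sigma> = 0"
  by (simp add: pd_def)

lemma pd_add:
  assumes "holo_on U f" "holo_on U g" "\<sigma> \<in> U"
  shows "pd h (\<lambda>\<sigma>. f \<sigma> + g \<sigma>) \<sigma> = pd h f \<sigma> + pd h g \<sigma>"
proof -
  from assms obtain L M where L: "(f has_derivative L) (at \<sigma>)" "\<And>c v. L (c *s v) = c * L v"
    and M: "(g has_derivative M) (at \<sigma>)" "\<And>c v. M (c *s v) = c * M v" by (metis holo_onE)
  have "pd h (\<lambda>\<sigma>. f \<sigma> + g \<sigma>) \<sigma> = L (axis (coord_index h) 1) + M (axis (coord_index h) 1)"
    by (rule pd_eqI[where L = "\<lambda>v. L v + M v"])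
       (use L M in \<open>auto intro!: derivative_intros simp: algebra_simps\<close>)
  then show ?thesis using L M by (simp add: pd_eqI)
qed

lemma pd_mult:
  assumes "holo_on U f" "holo_on U g" "\<sigma> \<in> U"
  shows "pd h (\<lambda>\<sigma>. f \<sigma> * g \<sigma>) \<sigma> = f \<sigma> * pd h g \<sigma> + pd h f \<sigma> * g \<sigma>"
proof -
  from assms obtain L M where L: "(f has_derivative L) (at \<sigma>)" "\<And>c v. L (c *s v) = c * L v"
    and M: "(g has_derivative M) (at \<sigma>)" "\<And>c v. M (c *s v) = c * M v" by (metis holo_onE)
  have "pd h (\<lambda>\<sigma>. f \<sigma> * g \<sigma>) \<sigma> = f \<sigma> * M (axis (coord_index h) 1) + L (axis (coord_index h) 1) * g \<sigma>"
    by (rule pd_eqI[where L = "\<lambda>v. f \<sigma> * M v + L v * g \<sigma>"])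
       (use L M in \<open>simp_all add: has_derivative_mult distrib_left mult.assoc mult.left_commute\<close>)
  then show ?thesis using L M by (simp add: pd_eqI)
qed

lemma pd_cmult:
  assumes "holo_on U f" "\<sigma> \<in> U" shows "pd h (\<lambda>\<sigma>. c * f \<sigma>) \<sigma> = c * pd h f \<sigma>"
  using pd_mult[OF holo_on_const assms] by simp

lemma pd_sum:
  assumes "\<And>i. i \<in> I \<Longrightarrow> holo_on U (f i)" "\<sigma> \<in> U"
  shows "pd h (\<lambda>\<sigma>. \<Sum>i\<in>I. f i \<sigma>) \<sigma> = (\<Sum>i\<in>I. pd h (f i) \<sigma>)"
  using assms(1)
proof (induction I rule: infinite_finite_induct)
  case (insert i I)
  then have "pd h (\<lambda>\<sigma>. f i \<sigma> + (\<Sum>i\<in>I. f i \<sigma>)) \<sigma> = pd h (f i) \<sigma> + pd h (\<lambda>\<sigma>. \<Sum>i\<in>I. f i \<sigma>) \<sigma>"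
    by (intro pd_add[where U=U] assms(2) holo_on_sum) auto
  with insert show ?case by simp
qed simp_all

lemma pd_coord:
  assumes "h \<in> {1..CARD('k)}" "m \<in> {1..CARD('k)}"
  shows "pd m (\<lambda>\<sigma> :: complex ^ 'k. coord \<sigma> h) \<sigma> = (if h = m then 1 else 0)"
proof -
  have "pd m (\<lambda>\<sigma> :: complex ^ 'k. coord \<sigma> h) \<sigma> = axis (coord_index m) 1 $ (coord_index h :: 'k)"
    unfolding coord_def
    by (rule pd_eqI) (auto intro!: bounded_linear_imp_has_derivative bounded_linear_vec_nth)
  then show ?thesis using coord_index_eq_iff[OF assms] by (auto simp: axis_def)
qed

text \<open>\<open>pd\<close> is local, because the trace of an open set on a coordinate line is
  open. Identities known only on an open set can thus be used under a further derivative.\<close>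

lemma pd_cong:
  assumes "open U" "\<sigma> \<in> U" "\<And>\<tau>. \<tau> \<in> U \<Longrightarrow> f \<tau> = g \<tau>"
  shows "pd h f \<sigma> = pd h g \<sigma>"
  unfolding pd_def
proof (rule deriv_cong_ev)
  have "continuous_on UNIV (\<lambda>t. \<sigma> + axis (coord_index h) t)"
    by (intro continuous_intros bounded_linear.continuous_on[OF bounded_linear_axis])
  then have "open ((\<lambda>t. \<sigma> + axis (coord_index h) t) -` U)"
    using assms(1) by (simp add: open_vimage)
  moreover have "0 \<in> (\<lambda>t. \<sigma> + axis (coord_index h) t) -` U"
    using assms(2) by (simp add: axis_def zero_vec_def[symmetric])
  ultimately show "\<forall>\<^sub>F t in nhds 0. f (\<sigma> + axis (coord_index h) t) = g (\<sigma> + axis (coord_index h) t)"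
    using assms(3) by (auto simp: eventually_nhds)
qed simp

lemma pd_chain:
  assumes "(\<phi> has_field_derivative d) (at (f \<sigma>))" "holo_on U f" "\<sigma> \<in> U"
  shows "pd h (\<lambda>\<sigma>. \<phi> (f \<sigma>)) \<sigma> = d * pd h f \<sigma>"
proof -
  from assms obtain L where L: "(f has_derivative L) (at \<sigma>)" "\<And>c v. L (c *s v) = c * L v"
    by (metis holo_onE)
  have "((\<lambda>\<sigma>. \<phi> (f \<sigma>)) has_derivative (\<lambda>v. d * L v)) (at \<sigma>)"
    using has_derivative_compose[OF L(1)] assms(1) by (simp add: has_field_derivative_def)
  from pd_eqI[OF this] show ?thesis using L by (simp add: pd_eqI)
qed

lemma holo_on_chain:
  assumes "\<And>z. z \<in> f ` U \<Longrightarrow> \<exists>d. (\<phi> has_field_derivative d) (at z)" "holo_on U f"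
  shows "holo_on U (\<lambda>\<sigma>. \<phi> (f \<sigma>))"
proof (rule holo_onI)
  fix \<sigma> assume \<sigma>: "\<sigma> \<in> U"
  with assms obtain L where L: "(f has_derivative L) (at \<sigma>)" "\<And>c v. L (c *s v) = c * L v"
    by (metis holo_onE)
  obtain d where d: "(\<phi> has_field_derivative d) (at (f \<sigma>))" using assms(1) \<sigma> by blast
  have "((\<lambda>\<sigma>. \<phi> (f \<sigma>)) has_derivative (\<lambda>v. d * L v)) (at \<sigma>)"
    using has_derivative_compose[OF L(1)] d by (simp add: has_field_derivative_def)
  then show "\<exists>L. ((\<lambda>\<sigma>. \<phi> (f \<sigma>)) has_derivative L) (at \<sigma>) \<and> (\<forall>c v. L (c *s v) = c * L v)"
    using L(2) by (intro exI[of _ "\<lambda>v. d * L v"]) (auto simp: algebra_simps)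
qed

section \<open>Cauchy's formula and the regularity of partial derivatives\<close>

lemma holo_on_has_derivative:
  fixes f :: "complex ^ 'k \<Rightarrow> complex"
  assumes "holo_on U f" "\<sigma> \<in> U"
  shows "(f has_derivative (\<lambda>v. \<Sum>h=1..CARD('k). v $ coord_index h * pd h f \<sigma>)) (at \<sigma>)"
proof -
  from assms obtain L where L: "(f has_derivative L) (at \<sigma>)" "\<And>c v. L (c *s v) = c * L v"
    by (metis holo_onE)
  interpret bounded_linear L using L(1) by (rule has_derivative_bounded_linear)
  have "L v = (\<Sum>h=1..CARD('k). v $ coord_index h * pd h f \<sigma>)" for v
  proof -
    have "L v = L (\<Sum>i\<in>UNIV. v $ i *s axis i 1)" by (simp add: basis_expansion)
    also have "\<dots> = (\<Sum>i\<in>UNIV. v $ i * L (axis i 1))" by (simp add: sum L(2))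
    also have "\<dots> = (\<Sum>h=1..CARD('k). v $ coord_index h * L (axis (coord_index h) 1))"
      by (rule sum.reindex_bij_betw[OF bij_betw_coord_index, symmetric])
    finally show ?thesis using L by (simp add: pd_eqI)
  qed
  then have "L = (\<lambda>v. \<Sum>h=1..CARD('k). v $ coord_index h * pd h f \<sigma>)" by blast
  with L(1) show ?thesis by simp
qed

text \<open>Cauchy's formula for the first derivative on a coordinate line through \<sigma>, written
  over a fixed interval so that \<sigma> becomes a parameter of the integrand.\<close>

lemma pd_circle_integral:
  fixes f :: "complex ^ 'k \<Rightarrow> complex"
  assumes "holo_on U f" "cball \<sigma> r \<subseteq> U" "r > 0"
  shows "pd h f \<sigma> = integral {0..1}
           (\<lambda>t. f (\<sigma> + axis (coord_index h) (circlepath 0 r t)) / circlepath 0 r t)"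
proof -
  let ?g = "\<lambda>t. f (\<sigma> + axis (coord_index h) t)"
  have D: "\<exists>d. (?g has_field_derivative d) (at t)" if "t \<in> cball 0 r" for t
  proof -
    have "\<sigma> + axis (coord_index h) t \<in> U" using that assms(2) by (force simp: dist_norm)
    with assms(1) obtain L where "(f has_derivative L) (at (\<sigma> + axis (coord_index h) t))"
      "\<And>c v. L (c *s v) = c * L v" by (metis holo_onE)
    then show ?thesis using has_field_derivative_along_axis by blast
  qed
  have 1: "continuous_on (cball 0 r) ?g"
    using D by (meson DERIV_isCont continuous_at_imp_continuous_on)
  have 2: "?g holomorphic_on ball 0 r"
    using D by (simp add: holomorphic_on_open)
  have "(?g has_field_derivative (1 / (2 * of_real pi * \<i>) *
          contour_integral (circlepath 0 r) (\<lambda>u. ?g u / (u - 0)^2))) (at 0)"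
    by (rule Cauchy_derivative_integral_circlepath[OF 1 2]) (use assms(3) in simp)
  then have "pd h f \<sigma> = 1 / (2 * of_real pi * \<i>) *
          contour_integral (circlepath 0 r) (\<lambda>u. ?g u / (u - 0)^2)"
    unfolding pd_def by (rule DERIV_imp_deriv)
  also have "\<dots> = integral {0..1} (\<lambda>t. 1 / (2 * of_real pi * \<i>) *
      (?g (circlepath 0 r t) / (circlepath 0 r t)^2 * vector_derivative (circlepath 0 r) (at t)))"
    unfolding contour_integral_integral diff_0_right by (rule integral_mult_right[symmetric])
  \<comment> \<open>On a circle centred at 0 the velocity is 2 pi i times the position, which
    cancels the outer constant and one power of the denominator.\<close>
  also have "\<dots> = integral {0..1} (\<lambda>t. ?g (circlepath 0 r t) / circlepath 0 r t)"
    unfolding vector_derivative_circlepath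
    using assms(3) by (intro integral_cong) (simp add: circlepath field_simps power2_eq_square)
  finally show ?thesis .
qed

lemma continuous_on_circle_translate:
  fixes G :: "complex ^ 'k \<Rightarrow> 'b::topological_space"
  assumes "continuous_on U G" "cball x (2 * r) \<subseteq> U" "r > 0"
  shows "continuous_on (ball x r \<times> cbox 0 1) (\<lambda>p. G (fst p + axis i (circlepath 0 r (snd p))))"
proof (rule continuous_on_compose2[OF assms(1)])
  show "continuous_on (ball x r \<times> cbox 0 1) (\<lambda>p. fst p + axis i (circlepath 0 r (snd p)))"
    unfolding circlepath
    by (intro continuous_intros bounded_linear.continuous_on[OF bounded_linear_axis])
  show "(\<lambda>p. fst p + axis i (circlepath 0 r (snd p))) ` (ball x r \<times> cbox 0 1) \<subseteq> U"
  proof clarsimp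
    fix \<sigma> t assume "dist x \<sigma> < r" and "0 \<le> t" "t \<le> (1::real)"
    have "dist x (\<sigma> + axis i (circlepath 0 r t)) \<le> dist x \<sigma> + norm (axis i (circlepath 0 r t))"
      by (metis dist_commute dist_norm dist_triangle add_diff_cancel_left' norm_minus_commute)
    also have "\<dots> \<le> 2 * r"
      using \<open>dist x \<sigma> < r\<close> assms(3) by (simp add: circlepath norm_mult)
    finally show "\<sigma> + axis i (circlepath 0 r t) \<in> U" using assms(2) by auto
  qed
qed

lemma circle_translate_mem:
  fixes x :: "complex ^ 'k"
  assumes "cball x (2 * r) \<subseteq> U" "r > 0" "\<sigma> \<in> ball x r"
  shows "\<sigma> + axis i (circlepath 0 r t) \<in> U" "cball \<sigma> r \<subseteq> U"
proof -
  have "dist x y \<le> 2 * r" if "dist \<sigma> y \<le> r" for y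
    using dist_triangle[of x y \<sigma>] assms(3) that by simp
  then have "cball \<sigma> r \<subseteq> cball x (2 * r)" by auto
  with assms(1) show "cball \<sigma> r \<subseteq> U" by blast
  moreover have "\<sigma> + axis i (circlepath 0 r t) \<in> cball \<sigma> r"
    using assms(2) by (simp add: dist_norm circlepath norm_mult)
  ultimately show "\<sigma> + axis i (circlepath 0 r t) \<in> U" by blast
qed

text \<open>The factor 2 leaves room for the circles of radius \<open>r\<close> around all points of
  \<open>ball x r\<close>, as \<open>circle_translate_mem\<close> requires.\<close>

lemma obtain_double_cball:
  fixes x :: "'a::metric_space"
  assumes "open U" "x \<in> U"
  obtains r where "r > 0" "cball x (2 * r) \<subseteq> U"
proof -
  obtain e where "e > 0" "cball x e \<subseteq> U" using assms open_contains_cball by blast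
  then show ?thesis by (intro that[of "e / 2"]) auto
qed

text \<open>\<open>holo_on\<close> asks for differentiability only. Continuity of the partial
  derivatives comes from Cauchy's formula, whose integrand is continuous; it is needed before that
  formula can itself be differentiated.\<close>

lemma continuous_on_pd:
  fixes f :: "complex ^ 'k \<Rightarrow> complex"
  assumes "open U" "holo_on U f"
  shows "continuous_on U (pd h f)"
proof (rule continuous_at_imp_continuous_on, safe)
  fix x assume "x \<in> U"
  with assms(1) obtain r where r: "r > 0" "cball x (2 * r) \<subseteq> U" by (rule obtain_double_cball)
  have "continuous_on (ball x r) (\<lambda>\<sigma>. integral (cbox 0 1)
           (\<lambda>t. f (\<sigma> + axis (coord_index h) (circlepath 0 r t)) / circlepath 0 r t))"
  proof (rule integral_continuous_on_param)
    show "continuous_on (ball x r \<times> cbox 0 1)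
       (\<lambda>(\<sigma>, t). f (\<sigma> + axis (coord_index h) (circlepath 0 r t)) / circlepath 0 r t)"
      using continuous_on_circle_translate[OF holo_on_continuous_on[OF assms(2)] r(2,1)] r(1)
      unfolding case_prod_beta
      by (intro continuous_on_divide) (auto simp: circlepath intro!: continuous_intros)
  qed
  then have "continuous_on (ball x r) (pd h f)"
    by (rule continuous_on_eq)
       (use pd_circle_integral[OF assms(2) circle_translate_mem(2)[OF r(2,1)] r(1)] in simp)
  then show "isCont (pd h f) x"
    using r(1) continuous_on_eq_continuous_at[OF open_ball, of x r "pd h f"] by simp
qed

text \<open>Once \<open>f\<close> is known to be continuously differentiable, Cauchy's formula for \<open>pd h f\<close> can be
  differentiated under the integral sign.\<close>

lemma has_derivative_pd:
  fixes f :: "complex ^ 'k \<Rightarrow> complex"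
  assumes "open U" "holo_on U f" and r: "r > 0" "cball x (2 * r) \<subseteq> U"
  shows "(pd h f has_derivative (\<lambda>v. integral {0..1} (\<lambda>t. (\<Sum>m=1..CARD('k). v $ coord_index m *
         pd m f (x + axis (coord_index h) (circlepath 0 r t))) / circlepath 0 r t))) (at x)"
proof -
  let ?i = "coord_index h :: 'k"
  \<comment> \<open>The Leibniz rule takes the derivative of the integrand as a continuous map into
    the space of bounded linear maps, so the differential is assembled there.\<close>
  define nth :: "'k \<Rightarrow> (complex ^ 'k) \<Rightarrow>\<^sub>L complex" where "nth i = Blinfun (\<lambda>v. v $ i)" for i
  have nth: "blinfun_apply (nth i) v = v $ i" for i v
    unfolding nth_def by (simp add: bounded_linear_Blinfun_apply bounded_linear_vec_nth)
  define D where "D \<sigma> t = (\<Sum>m=1..CARD('k).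
      blinfun_mult_left (pd m f (\<sigma> + axis ?i (circlepath 0 r t)) / circlepath 0 r t)
        o\<^sub>L nth (coord_index m))" for \<sigma> t
  have D: "blinfun_apply (D \<sigma> t) = (\<lambda>v. (\<Sum>m=1..CARD('k). v $ coord_index m *
         pd m f (\<sigma> + axis ?i (circlepath 0 r t))) / circlepath 0 r t)" for \<sigma> t
    by (simp add: D_def blinfun.sum_left nth sum_divide_distrib fun_eq_iff)
  have cont: "continuous_on (ball x r \<times> cbox 0 1) (\<lambda>(\<sigma>, t). D \<sigma> t)"
    unfolding D_def case_prod_beta
    by (intro continuous_on_sum bounded_bilinear.continuous_on[OF bounded_bilinear_blinfun_compose]
          bounded_linear.continuous_on[OF bounded_linear_blinfun_mult_left] continuous_on_const
          continuous_on_divide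
          continuous_on_circle_translate[OF continuous_on_pd[OF assms(1,2)] r(2,1)])
       (use r(1) in \<open>auto simp: circlepath intro!: continuous_intros\<close>)
  have "((\<lambda>\<sigma>. integral (cbox 0 1) (\<lambda>t. f (\<sigma> + axis ?i (circlepath 0 r t)) / circlepath 0 r t))
          has_derivative blinfun_apply (integral (cbox 0 1) (D x))) (at x within ball x r)"
  proof (rule leibniz_rule[OF _ _ cont])
    fix \<sigma> and t :: real assume \<sigma>: "\<sigma> \<in> ball x r"
    have "(f has_derivative (\<lambda>v. \<Sum>m=1..CARD('k). v $ coord_index m *
         pd m f (\<sigma> + axis ?i (circlepath 0 r t)))) (at (\<sigma> + axis ?i (circlepath 0 r t)))"
      by (rule holo_on_has_derivative[OF assms(2)]) (rule circle_translate_mem[OF r(2,1) \<sigma>])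
    then have "((\<lambda>\<sigma>. f (\<sigma> + axis ?i (circlepath 0 r t))) has_derivative (\<lambda>v. \<Sum>m=1..CARD('k).
         v $ coord_index m * pd m f (\<sigma> + axis ?i (circlepath 0 r t)))) (at \<sigma>)"
      by (rule has_derivative_compose[rotated]) (auto intro!: derivative_eq_intros)
    then have "((\<lambda>\<sigma>. f (\<sigma> + axis ?i (circlepath 0 r t)) / circlepath 0 r t) has_derivative
        blinfun_apply (D \<sigma> t)) (at \<sigma>)"
      unfolding D divide_inverse by (rule has_derivative_mult_left)
    then show "((\<lambda>\<sigma>. f (\<sigma> + axis ?i (circlepath 0 r t)) / circlepath 0 r t) has_derivative
        blinfun_apply (D \<sigma> t)) (at \<sigma> within ball x r)"
      by (rule has_derivative_at_withinI)
  next
    fix \<sigma> assume \<sigma>: "\<sigma> \<in> ball x r"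
    have "continuous_on (cbox 0 1) (\<lambda>t. f (\<sigma> + axis ?i (circlepath 0 r t)) / circlepath 0 r t)"
    proof (intro continuous_on_divide)
      have "continuous_on (cbox 0 1) (\<lambda>t. (\<lambda>p. f (fst p + axis ?i (circlepath 0 r (snd p)))) (\<sigma>, t))"
        by (rule continuous_on_compose2[OF continuous_on_circle_translate
              [OF holo_on_continuous_on[OF assms(2)] r(2,1)]]) (use \<sigma> in \<open>auto intro!: continuous_intros\<close>)
      then show "continuous_on (cbox 0 1) (\<lambda>t. f (\<sigma> + axis ?i (circlepath 0 r t)))" by simp
    qed (use r(1) in \<open>auto simp: circlepath intro!: continuous_intros\<close>)
    then show "(\<lambda>t. f (\<sigma> + axis ?i (circlepath 0 r t)) / circlepath 0 r t) integrable_on cbox 0 1"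
      by (rule integrable_continuous)
  qed (use r(1) in auto)
  then have der: "((\<lambda>\<sigma>. integral (cbox 0 1) (\<lambda>t. f (\<sigma> + axis ?i (circlepath 0 r t)) / circlepath 0 r t))
          has_derivative blinfun_apply (integral (cbox 0 1) (D x))) (at x)"
    using r(1) by (simp add: at_within_open[of x "ball x r"])
  have "(pd h f has_derivative blinfun_apply (integral (cbox 0 1) (D x))) (at x)"
    by (rule has_derivative_transform_within_open[OF der open_ball[of x r]])
       (use r(1) pd_circle_integral[OF assms(2) circle_translate_mem(2)[OF r(2,1)] r(1)] in auto)
  moreover have "continuous_on (cbox 0 1) (\<lambda>t. (\<lambda>(\<sigma>, t). D \<sigma> t) (x, t))"
    by (rule continuous_on_compose2[OF cont]) (use r(1) in \<open>auto intro!: continuous_intros\<close>)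
  then have int: "D x integrable_on {0..1}" by (simp add: integrable_continuous_interval)
  then have "blinfun_apply (integral (cbox 0 1) (D x))
      = (\<lambda>v. integral {0..1} (\<lambda>t. blinfun_apply (D x t) v))"
    by (simp add: blinfun_apply_integral fun_eq_iff)
  ultimately show ?thesis unfolding D by (simp only:)
qed

text \<open>The derivative obtained under the integral sign is complex linear, since a constant
  factor can be pulled out of the integral.\<close>

lemma holo_on_pd:
  fixes f :: "complex ^ 'k \<Rightarrow> complex"
  assumes "open U" "holo_on U f"
  shows "holo_on U (pd h f)"
proof (rule holo_onI)
  fix x assume "x \<in> U"
  with assms(1) obtain r where r: "r > 0" "cball x (2 * r) \<subseteq> U" by (rule obtain_double_cball)
  let ?L = "\<lambda>v. integral {0..1} (\<lambda>t. (\<Sum>m=1..CARD('k). v $ coord_index m *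
         pd m f (x + axis (coord_index h) (circlepath 0 r t))) / circlepath 0 r t)"
  have "?L (c *s v) = c * ?L v" for c v
  proof -
    have "?L (c *s v) = integral {0..1} (\<lambda>t. c * ((\<Sum>m=1..CARD('k). v $ coord_index m *
         pd m f (x + axis (coord_index h) (circlepath 0 r t))) / circlepath 0 r t))"
      by (simp add: sum_distrib_left mult.assoc)
    then show ?thesis by (simp only: integral_mult_right)
  qed
  with has_derivative_pd[OF assms r]
  show "\<exists>L. (pd h f has_derivative L) (at x) \<and> (\<forall>c v. L (c *s v) = c * L v)"
    by blast
qed

text \<open>Both sides are the Cauchy integral of \<open>pd m f\<close> over a circle in direction
  \<open>h\<close>: the left one by differentiating Cauchy's formula for \<open>pd h f\<close>, the
  right one by Cauchy's formula for \<open>pd m f\<close>.\<close>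

lemma pd_commute:
  fixes f :: "complex ^ 'k \<Rightarrow> complex"
  assumes "open U" "holo_on U f" "x \<in> U" and m: "m \<in> {1..CARD('k)}"
  shows "pd m (pd h f) x = pd h (pd m f) x"
proof -
  from assms(1,3) obtain r where r: "r > 0" "cball x (2 * r) \<subseteq> U" by (rule obtain_double_cball)
  define L where "L = (\<lambda>v :: complex ^ 'k. integral {0..1} (\<lambda>t. (\<Sum>m=1..CARD('k). v $ coord_index m *
         pd m f (x + axis (coord_index h) (circlepath 0 r t))) / circlepath 0 r t))"
  from holo_on_pd[OF assms(1,2)] assms(3) obtain M
    where M: "(pd h f has_derivative M) (at x)" "\<And>c v. M (c *s v) = c * M v"
    by (metis holo_onE)
  have "L = M" using has_derivative_pd[OF assms(1,2) r] M(1)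
    unfolding L_def by (rule has_derivative_unique)
  then have "pd m (pd h f) x = L (axis (coord_index m) 1)"
    using M by (simp add: pd_eqI)
  also have "\<dots> = integral {0..1} (\<lambda>t. pd m f (x + axis (coord_index h) (circlepath 0 r t)) / circlepath 0 r t)"
  proof -
    have "(\<Sum>j=1..CARD('k). axis (coord_index m) 1 $ (coord_index j :: 'k) * G j) = G m" for G :: "nat \<Rightarrow> complex"
    proof -
      have "(\<Sum>j=1..CARD('k). axis (coord_index m) 1 $ (coord_index j :: 'k) * G j)
          = (\<Sum>j=1..CARD('k). if j = m then G j else 0)"
        using m coord_index_eq_iff[where 'k='k] by (intro sum.cong) (auto simp: axis_def)
      with m show ?thesis by simp
    qed
    then show ?thesis unfolding L_def by simp
  qed
  also have "\<dots> = pd h (pd m f) x"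
    using pd_circle_integral[OF holo_on_pd[OF assms(1,2)], of x r h m] r by (force simp: subset_iff)
  finally show ?thesis .
qed

section \<open>Iterated derivatives and powers of the generating polynomial\<close>

text \<open>Derivatives are encoded as words whose last letter acts first. The order is the length
  and the weight the sum of the letters, and a chosen pair of letters can be rewritten.\<close>

definition pdl :: "nat list \<Rightarrow> 'k::finite operator" where
  "pdl L = foldr pd L"

lemma pdl_simps [simp]:
  "pdl [] f = f" "pdl (h # L) f = pd h (pdl L f)" "pdl (L @ M) f = pdl L (pdl M f)"
  by (simp_all add: pdl_def)

lemma holo_on_pdl:
  fixes f :: "complex ^ 'k \<Rightarrow> complex"
  assumes "open U" "holo_on U f" shows "holo_on U (pdl L f)"
  by (induction L) (auto intro: holo_on_pd assms)

lemma pdl_cong: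
  assumes "open U" "\<sigma> \<in> U" "\<And>\<tau>. \<tau> \<in> U \<Longrightarrow> f \<tau> = g \<tau>"
  shows "pdl L f \<sigma> = pdl L g \<sigma>"
  using assms(2) by (induction L arbitrary: \<sigma>) (auto intro: pd_cong[OF assms(1)] assms(3))

lemma pdl_zero: "pdl L (\<lambda>_. 0) \<sigma> = 0"
proof (induction L arbitrary: \<sigma>)
  case (Cons h L)
  have "pd h (pdl L (\<lambda>_. 0)) \<sigma> = pd h (\<lambda>_. 0) \<sigma>"
    by (rule pd_cong[OF open_UNIV UNIV_I Cons.IH])
  then show ?case by simp
qed simp

lemma pdl_add:
  assumes "open U" "holo_on U f" "holo_on U g" "\<sigma> \<in> U"
  shows "pdl L (\<lambda>\<sigma>. f \<sigma> + g \<sigma>) \<sigma> = pdl L f \<sigma> + pdl L g \<sigma>"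
  using assms(4)
proof (induction L arbitrary: \<sigma>)
  case (Cons h L)
  then have "pd h (pdl L (\<lambda>\<sigma>. f \<sigma> + g \<sigma>)) \<sigma> = pd h (\<lambda>\<sigma>. pdl L f \<sigma> + pdl L g \<sigma>) \<sigma>"
    by (intro pd_cong[OF assms(1)]) auto
  also have "\<dots> = pd h (pdl L f) \<sigma> + pd h (pdl L g) \<sigma>"
    by (rule pd_add[of U]) (auto intro: holo_on_pdl assms Cons)
  finally show ?case by simp
qed simp

lemma pdl_cmult:
  assumes "open U" "holo_on U f" "\<sigma> \<in> U"
  shows "pdl L (\<lambda>\<sigma>. c * f \<sigma>) \<sigma> = c * pdl L f \<sigma>"
  using assms(3)
proof (induction L arbitrary: \<sigma>)
  case (Cons h L)
  then have "pd h (pdl L (\<lambda>\<sigma>. c * f \<sigma>)) \<sigma> = pd h (\<lambda>\<sigma>. c * pdl L f \<sigma>) \<sigma>"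
    by (intro pd_cong[OF assms(1)]) auto
  also have "\<dots> = c * pd h (pdl L f) \<sigma>"
    by (rule pd_cmult[of U]) (auto intro: holo_on_pdl assms Cons)
  finally show ?case by simp
qed simp

lemma pdl_diff:
  assumes "open U" "holo_on U f" "holo_on U g" "\<sigma> \<in> U"
  shows "pdl L (\<lambda>\<sigma>. f \<sigma> - g \<sigma>) \<sigma> = pdl L f \<sigma> - pdl L g \<sigma>"
proof -
  have "holo_on U (\<lambda>\<sigma>. -1 * g \<sigma>)" using holo_on_minus[OF assms(3)] by simp
  from pdl_add[OF assms(1,2) this assms(4)] pdl_cmult[OF assms(1,3,4), of L "-1"]
  show ?thesis by simp
qed

lemma pdl_remove1:
  fixes f :: "complex ^ 'k \<Rightarrow> complex"
  assumes "open U" "holo_on U f" "\<sigma> \<in> U" "h \<in> set L" "set L \<subseteq> {1..CARD('k)}"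
  shows "pdl L f \<sigma> = pd h (pdl (remove1 h L) f) \<sigma>"
  using assms(3-5)
proof (induction L arbitrary: \<sigma>)
  case (Cons m L)
  show ?case
  proof (cases "m = h")
    case False
    have "pdl (m # L) f \<sigma> = pd m (pdl L f) \<sigma>" by simp
    also have "\<dots> = pd m (pd h (pdl (remove1 h L) f)) \<sigma>"
      using Cons False by (intro pd_cong[OF assms(1) Cons.prems(1)]) auto
    also have "\<dots> = pd h (pd m (pdl (remove1 h L) f)) \<sigma>"
      by (rule pd_commute[OF assms(1)]) (use Cons.prems in \<open>auto intro: holo_on_pdl assms\<close>)
    finally show ?thesis using False by simp
  qed simp
qed simp

text \<open>Partial derivatives of a holomorphic function commute, so any letter can be pulled to
  the front and the two words matched letter by letter.\<close>

lemma pdl_mset_cong: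
  fixes f :: "complex ^ 'k \<Rightarrow> complex"
  assumes "open U" "holo_on U f" "\<sigma> \<in> U" "mset L = mset M" "set M \<subseteq> {1..CARD('k)}"
  shows "pdl L f \<sigma> = pdl M f \<sigma>"
  using assms(3-5)
proof (induction M arbitrary: \<sigma> L)
  case (Cons h M)
  have L: "h \<in> set L" "set L \<subseteq> {1..CARD('k)}"
    using Cons.prems(2,3) mset_eq_setD by fastforce+
  have "pdl L f \<sigma> = pd h (pdl (remove1 h L) f) \<sigma>"
    by (rule pdl_remove1[OF assms(1,2) Cons.prems(1) L])
  also have "\<dots> = pd h (pdl M f) \<sigma>"
  proof (rule pd_cong[OF assms(1) Cons.prems(1)])
    fix \<tau> assume "\<tau> \<in> U"
    then show "pdl (remove1 h L) f \<tau> = pdl M f \<tau>"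
      by (rule Cons.IH) (use Cons.prems in auto)
  qed
  finally show ?case by simp
qed simp

text \<open>The sorted word with exponents \<alpha>, in the order in which \<open>pd_multi\<close>
  composes.\<close>

definition mlist :: "nat \<Rightarrow> (nat \<Rightarrow> nat) \<Rightarrow> nat list" where
  "mlist k \<alpha> = concat (map (\<lambda>h. replicate (\<alpha> h) h) [1..<Suc k])"

lemma pd_multi_eq_pdl: "pd_multi \<alpha> f = pdl (mlist CARD('k) \<alpha>) (f :: complex ^ 'k \<Rightarrow> complex)"
proof -
  have rep: "(pd h ^^ n) g = pdl (replicate n h) g" for h n and g :: "complex ^ 'k \<Rightarrow> complex"
    by (induction n) auto
  have "foldr (\<lambda>h D. (pd h ^^ \<alpha> h) \<circ> D) hs id f = pdl (concat (map (\<lambda>h. replicate (\<alpha> h) h) hs)) f"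
    for hs by (induction hs) (auto simp: rep)
  then show ?thesis unfolding pd_multi_def mlist_def .
qed

lemma set_mlist: "set (mlist k \<alpha>) \<subseteq> {1..k}"
  by (auto simp: mlist_def)

lemma sum_list_upt_eq: "sum_list (map g [1..<Suc k]) = (\<Sum>h=1..k. g h)"
  by (simp only: sum_set_upt_conv_sum_list_nat[symmetric] set_upt atLeastLessThanSuc_atLeastAtMost)

lemma length_mlist: "length (mlist k \<alpha>) = (\<Sum>h=1..k. \<alpha> h)"
proof -
  have "length (mlist k \<alpha>) = sum_list (map \<alpha> [1..<Suc k])"
    unfolding mlist_def by (simp add: length_concat o_def del: upt_Suc)
  then show ?thesis by (simp only: sum_list_upt_eq)
qed

lemma sum_list_mlist: "sum_list (mlist k \<alpha>) = (\<Sum>h=1..k. h * \<alpha> h)"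
proof -
  have "sum_list (concat (map (\<lambda>h. replicate (\<alpha> h) h) hs)) = sum_list (map (\<lambda>h. h * \<alpha> h) hs)" for hs
    by (induction hs) (auto simp: sum_list_replicate)
  then show ?thesis by (simp only: mlist_def sum_list_upt_eq)
qed

lemma mset_mlist_count:
  assumes "set L \<subseteq> {1..k}" shows "mset (mlist k (count (mset L))) = mset L"
proof (rule multiset_eqI)
  fix x
  have "count (mset (concat (map (\<lambda>h. replicate (n h) h) hs))) x = (if x \<in> set hs then n x else 0)"
    if "distinct hs" for n :: "nat \<Rightarrow> nat" and hs
    using that by (induction hs) (auto simp: count_replicate_mset)
  then have "count (mset (mlist k (count (mset L)))) x
      = (if x \<in> set [1..<Suc k] then count (mset L) x else 0)"
    unfolding mlist_def by (simp del: upt_Suc)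
  then show "count (mset (mlist k (count (mset L)))) x = count (mset L) x"
    using assms by (auto simp: not_in_iff[symmetric])
qed

section \<open>The generating polynomial and its complex powers\<close>

definition gen :: "complex \<Rightarrow> complex ^ 'k \<Rightarrow> complex" where
  "gen s \<sigma> = 1 + (\<Sum>h=1..CARD('k). (-1) ^ h * coord \<sigma> h * s ^ h)"

text \<open>On the right half-plane the principal logarithm is holomorphic and changes sign under
  inversion, so powers of \<open>gen\<close> obey the usual rules.\<close>

definition gen_dom :: "complex \<Rightarrow> (complex ^ 'k) set" where
  "gen_dom s = {\<sigma>. Re (gen s \<sigma>) > 0}"

lemma holo_on_gen: "holo_on U (gen s)"
  unfolding gen_def by (intro holo_on_add holo_on_sum holo_on_mult holo_on_const holo_on_coord)

lemma open_gen_dom: "open (gen_dom s)"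
  unfolding gen_dom_def
  by (intro open_Collect_less continuous_intros holo_on_continuous_on holo_on_gen)

lemma gen_dom_nonpos: "\<sigma> \<in> gen_dom s \<Longrightarrow> gen s \<sigma> \<notin> \<real>\<^sub>\<le>\<^sub>0"
  by (auto simp: gen_dom_def complex_nonpos_Reals_iff)

lemma gen_dom_nz: "\<sigma> \<in> gen_dom s \<Longrightarrow> gen s \<sigma> \<noteq> 0"
  using gen_dom_nonpos by fastforce

lemma pd_gen:
  assumes "h \<in> {1..CARD('k)}"
  shows "pd h (gen s) (\<sigma> :: complex ^ 'k) = (-1) ^ h * s ^ h"
proof -
  have "coord (\<sigma> + axis (coord_index h) t) j = coord \<sigma> j + (if j = h then t else 0)"
    if "j \<in> {1..CARD('k)}" for t j
    using coord_index_eq_iff[OF assms that] by (auto simp: coord_def axis_def)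
  then have "gen s (\<sigma> + axis (coord_index h) t) = 1 + (\<Sum>j=1..CARD('k).
      (-1) ^ j * coord \<sigma> j * s ^ j + (if j = h then (-1) ^ j * t * s ^ j else 0))" for t
    unfolding gen_def by (intro arg_cong2[where f="(+)"] refl sum.cong) (auto simp: algebra_simps)
  then have "gen s (\<sigma> + axis (coord_index h) t) = gen s \<sigma> + (-1) ^ h * t * s ^ h" for t
    using assms by (simp add: gen_def sum.distrib)
  then have "pd h (gen s) \<sigma> = deriv (\<lambda>t. gen s \<sigma> + (-1) ^ h * t * s ^ h) 0"
    by (simp add: pd_def)
  also have "\<dots> = (-1) ^ h * s ^ h"
    by (rule DERIV_imp_deriv) (auto intro!: derivative_eq_intros)
  finally show ?thesis .
qed

lemma holo_on_gen_powr: "holo_on (gen_dom s) (\<lambda>\<sigma>. gen s \<sigma> powr \<nu>)"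
  by (rule holo_on_chain[OF _ holo_on_gen])
     (use gen_dom_nonpos has_field_derivative_powr in blast)

lemma pd_gen_powr:
  fixes \<sigma> :: "complex ^ 'k"
  assumes "h \<in> {1..CARD('k)}" "\<sigma> \<in> gen_dom s"
  shows "pd h (\<lambda>\<sigma>. gen s \<sigma> powr \<nu>) \<sigma> = (-1) ^ h * \<nu> * s ^ h * gen s \<sigma> powr (\<nu> - 1)"
  using pd_chain[OF has_field_derivative_powr[OF gen_dom_nonpos[OF assms(2)]] holo_on_gen assms(2),
      where h = h] pd_gen[OF assms(1)] by simp

definition pd_factor :: "complex \<Rightarrow> nat \<Rightarrow> nat \<Rightarrow> complex" where
  "pd_factor \<nu> n w = (-1) ^ (n + w) * pochhammer \<nu> n"

lemma pd_factor_Suc: "pd_factor \<nu> (Suc n) (h + w) = (-1) ^ h * - (\<nu> + of_nat n) * pd_factor \<nu> n w"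
  by (simp add: pd_factor_def pochhammer_Suc power_add algebra_simps)

text \<open>\<open>gen s\<close> is affine in the coordinates, so each derivative only lowers the
  exponent by one and contributes a factor.\<close>

lemma pdl_gen_powr:
  fixes \<sigma> :: "complex ^ 'k"
  assumes "set L \<subseteq> {1..CARD('k)}" "\<sigma> \<in> gen_dom s"
  shows "pdl L (\<lambda>\<sigma>. gen s \<sigma> powr (- \<nu>)) \<sigma>
       = pd_factor \<nu> (length L) (sum_list L) * s ^ sum_list L * gen s \<sigma> powr (- \<nu> - of_nat (length L))"
  using assms
proof (induction L arbitrary: \<sigma>)
  case (Cons h L)
  have "pdl (h # L) (\<lambda>\<sigma>. gen s \<sigma> powr (- \<nu>)) \<sigma> = pd h (\<lambda>\<sigma>. pd_factor \<nu> (length L) (sum_list L) *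
     s ^ sum_list L * gen s \<sigma> powr (- \<nu> - of_nat (length L))) \<sigma>"
    using Cons by (auto intro!: pd_cong[OF open_gen_dom])
  also have "\<dots> = pd_factor \<nu> (length L) (sum_list L) * s ^ sum_list L *
      pd h (\<lambda>\<sigma>. gen s \<sigma> powr (- \<nu> - of_nat (length L))) \<sigma>"
    by (rule pd_cmult[OF holo_on_gen_powr Cons.prems(2)])
  finally show ?case using Cons.prems
    by (simp add: pd_gen_powr pd_factor_Suc power_add algebra_simps)
qed (simp add: pd_factor_def)

lemma P_poly_eq_gen: "a \<noteq> 0 \<Longrightarrow> P_poly \<sigma> a = a ^ CARD('k) * gen (1 / a) (\<sigma> :: complex ^ 'k)"
  unfolding P_poly_def gen_def distrib_left sum_distrib_left
  by (auto intro!: sum.cong simp: power_diff power_one_over divide_simps)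

lemma F_fun_eq_gen:
  fixes \<sigma> :: "complex ^ 'k"
  assumes "a \<noteq> 0" "\<sigma> \<in> gen_dom (1 / a)"
  shows "F_fun \<mu> a \<sigma> = gen (1 / a) \<sigma> powr (- \<mu>)"
proof -
  have "a ^ CARD('k) / P_poly \<sigma> a = inverse (gen (1 / a) \<sigma>)"
    using assms(1) by (simp add: P_poly_eq_gen field_simps)
  then show ?thesis
    using gen_dom_nz[OF assms(2)] gen_dom_nonpos[OF assms(2)]
    by (simp add: F_fun_def powr_def Ln_inverse)
qed

lemma holo_on_F_fun: "a \<noteq> 0 \<Longrightarrow> holo_on (gen_dom (1 / a)) (F_fun \<mu> a)"
  by (rule holo_on_cong[OF open_gen_dom holo_on_gen_powr]) (rule F_fun_eq_gen)

lemma pdl_F_fun: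
  fixes \<sigma> :: "complex ^ 'k"
  assumes "set L \<subseteq> {1..CARD('k)}" "a \<noteq> 0" "\<sigma> \<in> gen_dom (1 / a)"
  shows "pdl L (F_fun \<mu> a) \<sigma> = pd_factor \<mu> (length L) (sum_list L) * (1 / a) ^ sum_list L
           * gen (1 / a) \<sigma> powr (- \<mu> - of_nat (length L))"
proof -
  have "pdl L (F_fun \<mu> a) \<sigma> = pdl L (\<lambda>\<sigma>. gen (1 / a) \<sigma> powr (- \<mu>)) \<sigma>"
    by (rule pdl_cong[OF open_gen_dom assms(3)]) (rule F_fun_eq_gen[OF assms(2)])
  then show ?thesis using pdl_gen_powr[OF assms(1,3)] by simp
qed

text \<open>As \<open>a\<close> tends to infinity, \<open>gen (1 / a) x\<close> tends to 1. The
  radius is found for the point \<open>x\<close> alone; since \<open>gen_dom\<close> is open, each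
  single \<open>a\<close> beyond it also admits a neighbourhood of \<open>x\<close>.\<close>

lemma eventually_mem_gen_dom:
  fixes x :: "complex ^ 'k"
  shows "\<exists>r>0. \<forall>a. cmod a > r \<longrightarrow> x \<in> gen_dom (1 / a)"
proof -
  have "((\<lambda>a. gen (1 / a) x) \<longlongrightarrow> 1 + (\<Sum>h=1..CARD('k). (-1) ^ h * coord x h * 0 ^ h)) at_infinity"
    unfolding gen_def by (intro tendsto_intros tendsto_divide_0[OF tendsto_const] filterlim_ident)
  moreover have "1 + (\<Sum>h=1..CARD('k). (-1) ^ h * coord x h * 0 ^ h) = 1" by simp
  ultimately have "((\<lambda>a. Re (gen (1 / a) x)) \<longlongrightarrow> Re 1) at_infinity"
    by (metis tendsto_Re)
  then have "eventually (\<lambda>a. Re (gen (1 / a) x) > 0) at_infinity"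
    by (rule order_tendstoD) simp
  then obtain b where "\<And>a. cmod a \<ge> b \<Longrightarrow> x \<in> gen_dom (1 / a)"
    unfolding eventually_at_infinity gen_dom_def by auto
  then show ?thesis by (intro exI[of _ "max b 1"]) auto
qed

section \<open>The polynomials Phi\<close>

lemma finite_weight_indices: "finite (weight_indices k q)"
proof (rule finite_subset)
  show "weight_indices k q \<subseteq> {\<alpha>. \<forall>h. (h \<in> {1..k} \<longrightarrow> \<alpha> h \<in> {..q}) \<and> (h \<notin> {1..k} \<longrightarrow> \<alpha> h = 0)}"
  proof (clarsimp simp: weight_indices_def multi_indices_def)
    fix \<alpha> :: "nat \<Rightarrow> nat" and h assume h: "Suc 0 \<le> h" "h \<le> k"
    then have "h * \<alpha> h \<le> (\<Sum>h=Suc 0..k. h * \<alpha> h)" by (intro member_le_sum) auto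
    with h show "\<alpha> h \<le> (\<Sum>h=Suc 0..k. h * \<alpha> h)"
      by (metis One_nat_def Suc_le_lessD le_trans mult_le_mono1 nat_mult_1)
  qed
  show "finite {\<alpha>. \<forall>h. (h \<in> {1..k} \<longrightarrow> \<alpha> h \<in> {..q}) \<and> (h \<notin> {1..k} \<longrightarrow> \<alpha> h = (0::nat))}"
    by (rule finite_set_of_finite_funs) auto
qed

text \<open>Lowering the exponent at \<open>h\<close> by one is a bijection from the indices of
  weight \<open>q\<close> with positive exponent at \<open>h\<close> onto those of weight
  \<open>q - h\<close>. It serves both for differentiating and for multiplying by a
  coordinate.\<close>

lemma sum_weight_indices_shift:
  assumes h: "h \<in> {1..k}"
  shows "(\<Sum>\<alpha>\<in>weight_indices k q. if \<alpha> h > 0 then G (\<alpha>(h := \<alpha> h - 1)) else 0)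
       = (if h \<le> q then \<Sum>\<beta>\<in>weight_indices k (q - h). G \<beta> else (0 :: complex))"
proof -
  let ?W = "{\<alpha> \<in> weight_indices k q. \<alpha> h > 0}"
  have split: "(\<Sum>j=1..k. j * \<alpha> j) = h * \<alpha> h + (\<Sum>j\<in>{1..k} - {h}. j * \<alpha> j)" for \<alpha>
    using h by (subst sum.remove[of _ h]) auto
  have upd: "(\<Sum>j=1..k. j * (\<alpha>(h := x)) j) = h * x + (\<Sum>j\<in>{1..k} - {h}. j * \<alpha> j)" for \<alpha> x
    using h by (subst sum.remove[of _ h]) auto
  have le: "h \<le> q" if "\<alpha> \<in> ?W" for \<alpha>
  proof -
    have "h * 1 \<le> h * \<alpha> h" using that by (intro mult_le_mono2) auto
    moreover have "q = h * \<alpha> h + (\<Sum>j\<in>{1..k} - {h}. j * \<alpha> j)"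
      using that split[of \<alpha>] by (simp add: weight_indices_def)
    ultimately show ?thesis by linarith
  qed
  have "(\<Sum>\<alpha>\<in>weight_indices k q. if \<alpha> h > 0 then G (\<alpha>(h := \<alpha> h - 1)) else 0)
      = (\<Sum>\<alpha>\<in>?W. G (\<alpha>(h := \<alpha> h - 1)))"
    by (rule sum.inter_filter[OF finite_weight_indices, symmetric])
  also have "\<dots> = (if h \<le> q then \<Sum>\<beta>\<in>weight_indices k (q - h). G \<beta> else 0)"
  proof (cases "h \<le> q")
    case True
    have "(\<Sum>\<alpha>\<in>?W. G (\<alpha>(h := \<alpha> h - 1))) = (\<Sum>\<beta>\<in>weight_indices k (q - h). G \<beta>)"
    proof (rule sum.reindex_bij_witness[of _ "\<lambda>\<beta>. \<beta>(h := \<beta> h + 1)" "\<lambda>\<alpha>. \<alpha>(h := \<alpha> h - 1)"])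
      fix \<alpha> assume "\<alpha> \<in> ?W"
      moreover from this have "h * (\<alpha> h - 1) = h * \<alpha> h - h" by (simp add: diff_mult_distrib2)
      moreover have "h \<le> h * \<alpha> h" using \<open>\<alpha> \<in> ?W\<close> by simp
      ultimately show "\<alpha>(h := \<alpha> h - 1) \<in> weight_indices k (q - h)"
        using split[of \<alpha>] upd[of \<alpha> "\<alpha> h - 1"] h
        by (auto simp: weight_indices_def multi_indices_def)
    next
      fix \<beta> assume "\<beta> \<in> weight_indices k (q - h)"
      then show "\<beta>(h := \<beta> h + 1) \<in> ?W"
        using split[of \<beta>] upd[of \<beta> "\<beta> h + 1"] h True
        by (auto simp: weight_indices_def multi_indices_def algebra_simps)
    qed auto
    with True show ?thesis by simp
  next
    case False
    then have "?W = {}" using le by blast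
    with False show ?thesis by (simp only: sum.empty if_False)
  qed
  finally show ?thesis .
qed

definition wsize :: "nat \<Rightarrow> (nat \<Rightarrow> nat) \<Rightarrow> nat" where
  "wsize k \<alpha> = (\<Sum>h=1..k. \<alpha> h)"

text \<open>A divided power monomial in the signed coordinates: differentiation merely lowers an
  exponent, and the signs of the generating polynomial are absorbed.\<close>

definition signed_mon :: "(nat \<Rightarrow> nat) \<Rightarrow> complex ^ 'k \<Rightarrow> complex" where
  "signed_mon \<alpha> \<sigma> = (\<Prod>h=1..CARD('k). ((-1) ^ h * coord \<sigma> h) ^ \<alpha> h / fact (\<alpha> h))"

lemma wsize_upd:
  assumes "h \<in> {1..k}" "\<alpha> h > 0" shows "wsize k \<alpha> = Suc (wsize k (\<alpha>(h := \<alpha> h - 1)))"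
  using assms unfolding wsize_def by (simp add: sum.remove[of "{1..k}" h] del: One_nat_def)

lemma signed_mon_split:
  assumes "h \<in> {1..CARD('k)}"
  shows "signed_mon \<alpha> (\<sigma> :: complex ^ 'k) = ((-1) ^ h * coord \<sigma> h) ^ \<alpha> h / fact (\<alpha> h) *
     (\<Prod>j\<in>{1..CARD('k)} - {h}. ((-1) ^ j * coord \<sigma> j) ^ \<alpha> j / fact (\<alpha> j))"
  unfolding signed_mon_def using assms by (intro prod.remove) auto

lemma signed_mon_upd:
  assumes "h \<in> {1..CARD('k)}"
  shows "signed_mon (\<alpha>(h := n)) (\<sigma> :: complex ^ 'k) = ((-1) ^ h * coord \<sigma> h) ^ n / fact n *
     (\<Prod>j\<in>{1..CARD('k)} - {h}. ((-1) ^ j * coord \<sigma> j) ^ \<alpha> j / fact (\<alpha> j))"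
  unfolding signed_mon_split[OF assms] by (intro arg_cong2[where f="(*)"] prod.cong) auto

lemma pd_signed_mon:
  assumes h: "h \<in> {1..CARD('k)}"
  shows "pd h (signed_mon \<alpha>) (\<sigma> :: complex ^ 'k)
       = (if \<alpha> h > 0 then (-1) ^ h * signed_mon (\<alpha>(h := \<alpha> h - 1)) \<sigma> else 0)"
proof -
  let ?R = "\<Prod>j\<in>{1..CARD('k)} - {h}. ((-1) ^ j * coord \<sigma> j) ^ \<alpha> j / fact (\<alpha> j)"
  have "coord (\<sigma> + axis (coord_index h) t) j = coord \<sigma> j + (if j = h then t else 0)"
    if "j \<in> {1..CARD('k)}" for t j
    using coord_index_eq_iff[OF h that] by (auto simp: coord_def axis_def)
  note c = this
  have "signed_mon \<alpha> (\<sigma> + axis (coord_index h) t)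
      = ((-1) ^ h * (coord \<sigma> h + t)) ^ \<alpha> h / fact (\<alpha> h) * ?R" for t
    unfolding signed_mon_split[OF h] using h by (intro arg_cong2[where f="(*)"] prod.cong) (auto simp: c)
  then have "pd h (signed_mon \<alpha>) \<sigma>
      = deriv (\<lambda>t. ((-1) ^ h * (coord \<sigma> h + t)) ^ \<alpha> h / fact (\<alpha> h) * ?R) 0"
    by (simp add: pd_def)
  also have "\<dots> = of_nat (\<alpha> h) * (-1) ^ h * ((-1) ^ h * coord \<sigma> h) ^ (\<alpha> h - 1) / fact (\<alpha> h) * ?R"
    by (rule DERIV_imp_deriv) (auto intro!: derivative_eq_intros)
  also have "\<dots> = (if \<alpha> h > 0 then (-1) ^ h * signed_mon (\<alpha>(h := \<alpha> h - 1)) \<sigma> else 0)"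
    unfolding signed_mon_upd[OF h] by (cases "\<alpha> h") (simp_all add: field_simps del: of_nat_Suc)
  finally show ?thesis .
qed

lemma coord_times_signed_mon:
  assumes h: "h \<in> {1..CARD('k)}" and "\<alpha> h > 0"
  shows "(-1) ^ h * coord \<sigma> h * signed_mon (\<alpha>(h := \<alpha> h - 1)) \<sigma> = of_nat (\<alpha> h) * signed_mon \<alpha> (\<sigma> :: complex ^ 'k)"
  unfolding signed_mon_upd[OF h] signed_mon_split[OF h, of \<alpha>] using assms(2)
  by (cases "\<alpha> h") (simp_all add: field_simps del: of_nat_Suc)

lemma holo_on_signed_mon: "holo_on U (signed_mon \<alpha>)"
  unfolding signed_mon_def divide_inverse
  by (intro holo_on_prod holo_on_mult holo_on_power holo_on_const holo_on_coord)

lemma Phi_gen_eq_gen: "Phi_gen \<mu> = (\<lambda>\<sigma> :: complex ^ 'k. gen 1 \<sigma> powr (- \<mu>))"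
  by (simp add: Phi_gen_def gen_def fun_eq_iff)

lemma gen_at_0: "gen s 0 = 1"
  by (simp add: gen_def coord_def)

text \<open>The Taylor coefficients come from \<open>pdl_gen_powr\<close> at \<sigma> = 0, where
  \<open>gen 1\<close> equals 1. The sign given by the weight goes into the monomial, the one given
  by the degree \<open>wsize\<close> remains.\<close>

lemma Phi_eq_signed_mon:
  "Phi \<mu> q (\<sigma> :: complex ^ 'k) = (\<Sum>\<alpha>\<in>weight_indices CARD('k) q.
     (-1) ^ wsize CARD('k) \<alpha> * pochhammer \<mu> (wsize CARD('k) \<alpha>) * signed_mon \<alpha> \<sigma>)"
  unfolding Phi_def
proof (rule sum.cong[OF refl])
  fix \<alpha> assume "\<alpha> \<in> weight_indices CARD('k) q"
  then have q: "(\<Sum>h=1..CARD('k). h * \<alpha> h) = q" by (simp add: weight_indices_def)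
  have "pd_multi \<alpha> (Phi_gen \<mu>) (0 :: complex ^ 'k) = pd_factor \<mu> (wsize CARD('k) \<alpha>) q"
    unfolding pd_multi_eq_pdl Phi_gen_eq_gen
    by (subst pdl_gen_powr[OF set_mlist])
       (simp_all add: gen_dom_def gen_at_0 length_mlist sum_list_mlist q[simplified] wsize_def)
  moreover have "signed_mon \<alpha> \<sigma> = (-1) ^ q * (\<Prod>h=1..CARD('k). coord \<sigma> h ^ \<alpha> h)
      / (\<Prod>h=1..CARD('k). fact (\<alpha> h))"
    unfolding signed_mon_def q[symmetric]
    by (simp add: prod_dividef power_mult_distrib prod.distrib power_sum power_mult)
  ultimately show "pd_multi \<alpha> (Phi_gen \<mu>) (0 :: complex ^ 'k) / (\<Prod>h=1..CARD('k). fact (\<alpha> h))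
      * (\<Prod>h=1..CARD('k). coord \<sigma> h ^ \<alpha> h)
      = (-1) ^ wsize CARD('k) \<alpha> * pochhammer \<mu> (wsize CARD('k) \<alpha>) * signed_mon \<alpha> \<sigma>"
    by (simp add: pd_factor_def power_add)
qed

lemma holo_on_Phi: "holo_on U (Phi \<mu> q)"
  unfolding Phi_eq_signed_mon[abs_def] by (intro holo_on_sum holo_on_mult holo_on_const holo_on_signed_mon)

section \<open>The generating series of the polynomials \<open>Phi\<close>\<close>

definition upoly :: "complex ^ 'k \<Rightarrow> complex poly" where
  "upoly \<sigma> = 1 + (\<Sum>h=1..CARD('k). monom ((-1) ^ h * coord \<sigma> h) h)"

lemma poly_upoly: "poly (upoly \<sigma>) s = gen s \<sigma>"
  by (simp add: upoly_def gen_def poly_sum poly_monom)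

lemma degree_upoly: "degree (upoly (\<sigma> :: complex ^ 'k)) \<le> CARD('k)"
  unfolding upoly_def by (intro degree_add_le degree_sum_le) (auto intro: order_trans[OF degree_monom_le])

lemma coeff_upoly_0: "coeff (upoly \<sigma>) 0 = 1"
  by (simp add: upoly_def coeff_sum)

text \<open>The formal counterpart, in the variable s, of
  \<open>gen s \<sigma> powr (- \<nu>)\<close>. Its identities are proved coefficient by
  coefficient, without convergence.\<close>

definition Psi :: "complex \<Rightarrow> complex ^ 'k \<Rightarrow> complex fps" where
  "Psi \<nu> \<sigma> = Abs_fps (\<lambda>q. Phi \<nu> q \<sigma>)"

text \<open>The formal version of \<open>pd_gen_powr\<close>: the rule \<open>pochhammer_rec\<close>
  splits off the factor \<nu> and raises the parameter to \<nu> + 1.\<close>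

lemma pd_Phi:
  assumes h: "h \<in> {1..CARD('k)}"
  shows "pd h (Phi \<nu> q) (\<sigma> :: complex ^ 'k) = - \<nu> * (-1) ^ h * fps_nth (fps_X ^ h * Psi (\<nu> + 1) \<sigma>) q"
proof -
  let ?n = "wsize CARD('k)" and ?W = "weight_indices CARD('k)"
  have "pd h (Phi \<nu> q) \<sigma> = (\<Sum>\<alpha>\<in>?W q. pd h (\<lambda>\<sigma>. (-1) ^ ?n \<alpha> * pochhammer \<nu> (?n \<alpha>) * signed_mon \<alpha> \<sigma>) \<sigma>)"
    unfolding Phi_eq_signed_mon[abs_def]
    by (rule pd_sum[of _ UNIV]) (auto intro!: holo_on_signed_mon)
  also have "\<dots> = (\<Sum>\<alpha>\<in>?W q. (-1) ^ ?n \<alpha> * pochhammer \<nu> (?n \<alpha>) * pd h (signed_mon \<alpha>) \<sigma>)"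
    by (intro sum.cong refl pd_cmult[of UNIV] holo_on_signed_mon) auto
  also have "\<dots> = (\<Sum>\<alpha>\<in>?W q. if \<alpha> h > 0 then (\<lambda>\<beta>. - \<nu> * (-1) ^ h *
      ((-1) ^ ?n \<beta> * pochhammer (\<nu> + 1) (?n \<beta>) * signed_mon \<beta> \<sigma>)) (\<alpha>(h := \<alpha> h - 1)) else 0)"
    by (intro sum.cong refl) (simp add: pd_signed_mon[OF h] wsize_upd[OF h] pochhammer_rec)
  also have "\<dots> = (if h \<le> q then \<Sum>\<beta>\<in>?W (q - h). - \<nu> * (-1) ^ h *
      ((-1) ^ ?n \<beta> * pochhammer (\<nu> + 1) (?n \<beta>) * signed_mon \<beta> \<sigma>) else 0)"
    by (rule sum_weight_indices_shift[OF h])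
  also have "\<dots> = (if h \<le> q then - \<nu> * (-1) ^ h * Phi (\<nu> + 1) (q - h) \<sigma> else 0)"
    by (simp only: Phi_eq_signed_mon sum_distrib_left)
  finally show ?thesis by (simp add: fps_X_power_mult_nth Psi_def)
qed

text \<open>This is u^(-\<nu>) = u * u^(-\<nu>-1). Multiplication by the term of u with index
  \<open>h\<close> raises the exponent at \<open>h\<close>, and summing over \<open>h\<close>
  produces the total degree as a factor.\<close>

lemma Psi_step: "Psi \<nu> (\<sigma> :: complex ^ 'k) = fps_of_poly (upoly \<sigma>) * Psi (\<nu> + 1) \<sigma>"
proof (rule fps_ext)
  fix q
  let ?n = "wsize CARD('k)" and ?W = "weight_indices CARD('k)"
  let ?b = "\<lambda>n. (-1) ^ n * pochhammer (\<nu> + 1) n"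
  have h: "(-1) ^ h * coord \<sigma> h * fps_nth (fps_X ^ h * Psi (\<nu> + 1) \<sigma>) q
      = (\<Sum>\<alpha>\<in>?W q. of_nat (\<alpha> h) * ?b (?n \<alpha> - 1) * signed_mon \<alpha> \<sigma>)" if h: "h \<in> {1..CARD('k)}" for h
  proof -
    have "(-1) ^ h * coord \<sigma> h * fps_nth (fps_X ^ h * Psi (\<nu> + 1) \<sigma>) q =
      (if h \<le> q then \<Sum>\<beta>\<in>?W (q - h). (-1) ^ h * coord \<sigma> h * (?b (?n \<beta>) * signed_mon \<beta> \<sigma>) else 0)"
      by (simp add: fps_X_power_mult_nth Psi_def Phi_eq_signed_mon sum_distrib_left)
    also have "\<dots> = (\<Sum>\<alpha>\<in>?W q. if \<alpha> h > 0 then (\<lambda>\<beta>. (-1) ^ h * coord \<sigma> h *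
        (?b (?n \<beta>) * signed_mon \<beta> \<sigma>)) (\<alpha>(h := \<alpha> h - 1)) else 0)"
      by (rule sum_weight_indices_shift[OF h, symmetric])
    also have "\<dots> = (\<Sum>\<alpha>\<in>?W q. of_nat (\<alpha> h) * ?b (?n \<alpha> - 1) * signed_mon \<alpha> \<sigma>)"
    proof (intro sum.cong refl)
      fix \<alpha>
      show "(if \<alpha> h > 0 then (\<lambda>\<beta>. (-1) ^ h * coord \<sigma> h *
        (?b (?n \<beta>) * signed_mon \<beta> \<sigma>)) (\<alpha>(h := \<alpha> h - 1)) else 0) = of_nat (\<alpha> h) * ?b (?n \<alpha> - 1) * signed_mon \<alpha> \<sigma>"
        using coord_times_signed_mon[OF h, of \<alpha> \<sigma>] wsize_upd[OF h, of \<alpha>] by (auto simp: mult_ac)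
    qed
    finally show ?thesis .
  qed
  \<comment> \<open>Up to sign this is (\<nu>+1)_n - n (\<nu>+1)_(n-1) = (\<nu>)_n in Pochhammer
    symbols; for n = 0 the truncated \<open>n - 1\<close> is multiplied by 0.\<close>
  have b: "?b n + of_nat n * ?b (n - 1) = (-1) ^ n * pochhammer \<nu> n" for n
  proof (cases n)
    case (Suc m)
    then show ?thesis using pochhammer_Suc[of "\<nu> + 1" m] pochhammer_rec[of \<nu> m]
      by (simp add: algebra_simps)
  qed simp
  have "fps_nth (fps_of_poly (upoly \<sigma>) * Psi (\<nu> + 1) \<sigma>) q = Phi (\<nu> + 1) q \<sigma> +
      (\<Sum>h=1..CARD('k). (-1) ^ h * coord \<sigma> h * fps_nth (fps_X ^ h * Psi (\<nu> + 1) \<sigma>) q)"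
    by (simp add: upoly_def fps_of_poly_add fps_of_poly_sum fps_of_poly_monom distrib_right
        sum_distrib_right fps_sum_nth mult.assoc Psi_def)
  also have "\<dots> = Phi (\<nu> + 1) q \<sigma> + (\<Sum>h=1..CARD('k). \<Sum>\<alpha>\<in>?W q. of_nat (\<alpha> h) * ?b (?n \<alpha> - 1) * signed_mon \<alpha> \<sigma>)"
    by (intro arg_cong2[where f="(+)"] refl sum.cong h)
  also have "\<dots> = (\<Sum>\<alpha>\<in>?W q. ?b (?n \<alpha>) * signed_mon \<alpha> \<sigma>) +
      (\<Sum>\<alpha>\<in>?W q. of_nat (?n \<alpha>) * ?b (?n \<alpha> - 1) * signed_mon \<alpha> \<sigma>)"
    by (subst sum.swap) (simp add: Phi_eq_signed_mon wsize_def sum_distrib_right)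
  also have "\<dots> = (\<Sum>\<alpha>\<in>?W q. (?b (?n \<alpha>) + of_nat (?n \<alpha>) * ?b (?n \<alpha> - 1)) * signed_mon \<alpha> \<sigma>)"
    by (simp only: sum.distrib[symmetric] distrib_right)
  also have "\<dots> = fps_nth (Psi \<nu> \<sigma>) q"
    unfolding b by (simp add: Psi_def Phi_eq_signed_mon)
  finally show "fps_nth (Psi \<nu> \<sigma>) q = fps_nth (fps_of_poly (upoly \<sigma>) * Psi (\<nu> + 1) \<sigma>) q" ..
qed

text \<open>Brings derivatives of different orders to one common parameter, so that they can be
  added.\<close>

lemma Psi_shift: "Psi \<nu> \<sigma> = fps_of_poly (upoly \<sigma> ^ n) * Psi (\<nu> + of_nat n) \<sigma>"
proof (induction n)
  case (Suc n)
  then show ?case using Psi_step[of "\<nu> + of_nat n" \<sigma>]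
    by (simp add: fps_of_poly_mult mult_ac add_ac)
qed simp

text \<open>Only the zero index has weight 0. Constant term 1 ensures that the lowest coefficient of
  a symbol survives multiplication by \<open>Psi\<close>.\<close>

lemma Psi_nth_0: "fps_nth (Psi \<nu> \<sigma>) 0 = 1"
proof -
  have "weight_indices CARD('a) 0 = {\<lambda>_. 0}"
    by (auto simp: weight_indices_def multi_indices_def fun_eq_iff) (metis atLeastAtMost_iff le_0_eq not_less_eq_eq One_nat_def)
  then show ?thesis by (simp add: Psi_def Phi_eq_signed_mon signed_mon_def wsize_def)
qed

text \<open>The formal counterpart of \<open>pdl_gen_powr\<close>, with the same constants; this is
  why one symbol serves both families.\<close>

lemma pdl_Phi:
  fixes \<sigma> :: "complex ^ 'k"
  assumes "set L \<subseteq> {1..CARD('k)}"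
  shows "pdl L (Phi \<nu> q) \<sigma> = pd_factor \<nu> (length L) (sum_list L) *
     fps_nth (fps_X ^ sum_list L * Psi (\<nu> + of_nat (length L)) \<sigma>) q"
  using assms
proof (induction L arbitrary: \<sigma>)
  case (Cons h L)
  let ?e = "pd_factor \<nu> (length L) (sum_list L)" and ?\<nu> = "\<nu> + of_nat (length L)" and ?w = "sum_list L"
  have "pdl (h # L) (Phi \<nu> q) \<sigma> = pd h (\<lambda>\<sigma>. ?e * fps_nth (fps_X ^ ?w * Psi ?\<nu> \<sigma>) q) \<sigma>"
    unfolding pdl_simps by (rule pd_cong[OF open_UNIV UNIV_I Cons.IH]) (use Cons.prems in auto)
  also have "\<dots> = ?e * (if ?w \<le> q then pd h (Phi ?\<nu> (q - ?w)) \<sigma> else 0)"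
    by (auto simp: fps_X_power_mult_nth Psi_def intro!: pd_cmult[of UNIV] holo_on_Phi)
  also have "\<dots> = ?e * (- ?\<nu> * (-1) ^ h) * fps_nth (fps_X ^ (h + ?w) * Psi (?\<nu> + 1) \<sigma>) q"
    using Cons.prems by (auto simp: pd_Phi fps_X_power_mult_nth mult_ac add_ac)
  finally show ?case by (simp add: pd_factor_Suc mult_ac add_ac)
qed (simp add: pd_factor_def Psi_def)

section \<open>Germs of differential operators and their symbols\<close>

lemma holo_germsE:
  assumes "f \<in> holo_germs x" obtains U where "open U" "x \<in> U" "holo_on U f"
  using assms by (auto simp: holo_germs_def)

lemma holo_germs_const [intro!]: "(\<lambda>_. c) \<in> holo_germs x"
  unfolding holo_germs_def by (intro CollectI exI[of _ UNIV]) auto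

lemma holo_germs_coord [intro!]: "(\<lambda>\<sigma>. coord \<sigma> h) \<in> holo_germs x"
  unfolding holo_germs_def by (intro CollectI exI[of _ UNIV]) auto

lemma holo_germs_add [intro!]:
  assumes "f \<in> holo_germs x" "g \<in> holo_germs x" shows "(\<lambda>\<sigma>. f \<sigma> + g \<sigma>) \<in> holo_germs x"
proof -
  from assms obtain U V where "open U" "x \<in> U" "holo_on U f" "open V" "x \<in> V" "holo_on V g"
    by (metis holo_germsE)
  then show ?thesis unfolding holo_germs_def
    by (intro CollectI exI[of _ "U \<inter> V"]) (auto intro: holo_on_subset)
qed

lemma holo_germs_mult [intro!]:
  assumes "f \<in> holo_germs x" "g \<in> holo_germs x" shows "(\<lambda>\<sigma>. f \<sigma> * g \<sigma>) \<in> holo_germs x"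
proof -
  from assms obtain U V where "open U" "x \<in> U" "holo_on U f" "open V" "x \<in> V" "holo_on V g"
    by (metis holo_germsE)
  then show ?thesis unfolding holo_germs_def
    by (intro CollectI exI[of _ "U \<inter> V"]) (auto intro: holo_on_subset)
qed

lemma same_germI:
  assumes "\<And>V f \<sigma>. open V \<Longrightarrow> holo_on V f \<Longrightarrow> \<sigma> \<in> V \<Longrightarrow> P f \<sigma> = Q f \<sigma>"
  shows "same_germ x P Q"
  unfolding same_germ_def using assms by (intro exI[of _ UNIV]) auto

lemma same_germE:
  assumes "same_germ x P Q"
  obtains U where "open U" "x \<in> U"
    "\<And>V f \<sigma>. open V \<Longrightarrow> V \<subseteq> U \<Longrightarrow> holo_on V f \<Longrightarrow> \<sigma> \<in> V \<Longrightarrow> P f \<sigma> = Q f \<sigma>"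
proof -
  from assms obtain U where U: "open U" "x \<in> U"
    "\<forall>V f. open V \<and> V \<subseteq> U \<and> holo_on V f \<longrightarrow> (\<forall>\<sigma>\<in>V. P f \<sigma> = Q f \<sigma>)"
    unfolding same_germ_def by blast
  show ?thesis by (rule that[OF U(1,2)]) (use U(3) in simp)
qed

lemma same_germ_refl: "same_germ x P P"
  by (rule same_germI) simp

lemma same_germ_map2:
  assumes "same_germ x P P'" "same_germ x Q Q'"
  shows "same_germ x (\<lambda>f \<sigma>. H \<sigma> (P f \<sigma>) (Q f \<sigma>)) (\<lambda>f \<sigma>. H \<sigma> (P' f \<sigma>) (Q' f \<sigma>))"
proof -
  from assms(1) obtain U where U: "open U" "x \<in> U"
    "\<forall>V f. open V \<and> V \<subseteq> U \<and> holo_on V f \<longrightarrow> (\<forall>\<sigma>\<in>V. P f \<sigma> = P' f \<sigma>)"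
    unfolding same_germ_def by blast
  from assms(2) obtain U' where U': "open U'" "x \<in> U'"
    "\<forall>V f. open V \<and> V \<subseteq> U' \<and> holo_on V f \<longrightarrow> (\<forall>\<sigma>\<in>V. Q f \<sigma> = Q' f \<sigma>)"
    unfolding same_germ_def by blast
  show ?thesis unfolding same_germ_def
    by (rule exI[of _ "U \<inter> U'"]) (use U U' in auto)
qed

lemma same_germ_trans:
  assumes "same_germ x P Q" "same_germ x Q R" shows "same_germ x P R"
proof -
  from assms(1) obtain U where U: "open U" "x \<in> U"
    "\<forall>V f. open V \<and> V \<subseteq> U \<and> holo_on V f \<longrightarrow> (\<forall>\<sigma>\<in>V. P f \<sigma> = Q f \<sigma>)"
    unfolding same_germ_def by blast
  from assms(2) obtain U' where U': "open U'" "x \<in> U'"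
    "\<forall>V f. open V \<and> V \<subseteq> U' \<and> holo_on V f \<longrightarrow> (\<forall>\<sigma>\<in>V. Q f \<sigma> = R f \<sigma>)"
    unfolding same_germ_def by blast
  show ?thesis unfolding same_germ_def
    by (rule exI[of _ "U \<inter> U'"]) (use U U' in auto)
qed

lemma same_germ_add:
  "same_germ x P P' \<Longrightarrow> same_germ x Q Q' \<Longrightarrow>
    same_germ x (\<lambda>f \<sigma>. P f \<sigma> + Q f \<sigma>) (\<lambda>f \<sigma>. P' f \<sigma> + Q' f \<sigma>)"
  by (rule same_germ_map2)

lemma same_germ_diff:
  "same_germ x P P' \<Longrightarrow> same_germ x Q Q' \<Longrightarrow>
    same_germ x (\<lambda>f \<sigma>. P f \<sigma> - Q f \<sigma>) (\<lambda>f \<sigma>. P' f \<sigma> - Q' f \<sigma>)"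
  by (rule same_germ_map2)

lemma same_germ_cmult:
  "same_germ x P P' \<Longrightarrow> same_germ x (\<lambda>f \<sigma>. c \<sigma> * P f \<sigma>) (\<lambda>f \<sigma>. c \<sigma> * P' f \<sigma>)"
  using same_germ_map2[of x P P' P P' "\<lambda>\<sigma> u v. c \<sigma> * u"] by simp

lemma diffop_germsI:
  assumes "finite A" "A \<subseteq> multi_indices CARD('k)" "\<And>\<alpha>. \<alpha> \<in> A \<Longrightarrow> c \<alpha> \<in> holo_germs (x :: complex ^ 'k)"
    "same_germ x P (\<lambda>f \<sigma>. \<Sum>\<alpha>\<in>A. c \<alpha> \<sigma> * pd_multi \<alpha> f \<sigma>)"
  shows "P \<in> diffop_germs x"
  unfolding diffop_germs_def using assms by blast

lemma diffop_germsE: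
  assumes "P \<in> diffop_germs (x :: complex ^ 'k)"
  obtains A c where "finite A" "A \<subseteq> multi_indices CARD('k)" "\<And>\<alpha>. \<alpha> \<in> A \<Longrightarrow> c \<alpha> \<in> holo_germs x"
    "same_germ x P (\<lambda>f \<sigma>. \<Sum>\<alpha>\<in>A. c \<alpha> \<sigma> * pd_multi \<alpha> f \<sigma>)"
  using assms unfolding diffop_germs_def by blast

lemma diffop_germs_zero: "(\<lambda>f \<sigma>. 0) \<in> diffop_germs x"
  by (rule diffop_germsI[of "{}" undefined]) (auto intro: same_germ_refl)

lemma diffop_germs_cmult:
  assumes "P \<in> diffop_germs x" "b \<in> holo_germs x"
  shows "(\<lambda>f \<sigma>. b \<sigma> * P f \<sigma>) \<in> diffop_germs x"
proof -
  from assms(1) obtain A c where A: "finite A" "A \<subseteq> multi_indices CARD('a)"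
    "\<And>\<alpha>. \<alpha> \<in> A \<Longrightarrow> c \<alpha> \<in> holo_germs x"
    and P: "same_germ x P (\<lambda>f \<sigma>. \<Sum>\<alpha>\<in>A. c \<alpha> \<sigma> * pd_multi \<alpha> f \<sigma>)"
    by (rule diffop_germsE) blast
  have "same_germ x (\<lambda>f \<sigma>. b \<sigma> * P f \<sigma>) (\<lambda>f \<sigma>. \<Sum>\<alpha>\<in>A. (b \<sigma> * c \<alpha> \<sigma>) * pd_multi \<alpha> f \<sigma>)"
    using same_germ_cmult[OF P, of b] by (simp add: sum_distrib_left mult.assoc)
  with A assms(2) show ?thesis by (intro diffop_germsI[of A "\<lambda>\<alpha> \<sigma>. b \<sigma> * c \<alpha> \<sigma>"]) auto
qed

lemma diffop_germs_add:
  assumes "P \<in> diffop_germs x" "Q \<in> diffop_germs x"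
  shows "(\<lambda>f \<sigma>. P f \<sigma> + Q f \<sigma>) \<in> diffop_germs x"
proof -
  from assms(1) obtain A c where A: "finite A" "A \<subseteq> multi_indices CARD('a)"
    "\<And>\<alpha>. \<alpha> \<in> A \<Longrightarrow> c \<alpha> \<in> holo_germs x"
    and P: "same_germ x P (\<lambda>f \<sigma>. \<Sum>\<alpha>\<in>A. c \<alpha> \<sigma> * pd_multi \<alpha> f \<sigma>)"
    by (rule diffop_germsE) blast
  from assms(2) obtain B d where B: "finite B" "B \<subseteq> multi_indices CARD('a)"
    "\<And>\<alpha>. \<alpha> \<in> B \<Longrightarrow> d \<alpha> \<in> holo_germs x"
    and Q: "same_germ x Q (\<lambda>f \<sigma>. \<Sum>\<alpha>\<in>B. d \<alpha> \<sigma> * pd_multi \<alpha> f \<sigma>)"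
    by (rule diffop_germsE) blast
  \<comment> \<open>The two families of coefficients are extended by zero to the union of their
    index sets.\<close>
  define e where "e \<alpha> \<sigma> = (if \<alpha> \<in> A then c \<alpha> \<sigma> else 0) + (if \<alpha> \<in> B then d \<alpha> \<sigma> else 0)" for \<alpha> \<sigma>
  have "(\<Sum>\<alpha>\<in>A \<union> B. e \<alpha> \<sigma> * D \<alpha>) = (\<Sum>\<alpha>\<in>A. c \<alpha> \<sigma> * D \<alpha>) + (\<Sum>\<alpha>\<in>B. d \<alpha> \<sigma> * D \<alpha>)" for \<sigma> D
  proof -
    have "(\<Sum>\<alpha>\<in>A \<union> B. e \<alpha> \<sigma> * D \<alpha>) = (\<Sum>\<alpha>\<in>A \<union> B. if \<alpha> \<in> A then c \<alpha> \<sigma> * D \<alpha> else 0)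
        + (\<Sum>\<alpha>\<in>A \<union> B. if \<alpha> \<in> B then d \<alpha> \<sigma> * D \<alpha> else 0)"
      unfolding sum.distrib[symmetric] e_def by (intro sum.cong) (auto simp: algebra_simps)
    moreover have "(\<Sum>\<alpha>\<in>A \<union> B. if \<alpha> \<in> A then c \<alpha> \<sigma> * D \<alpha> else 0) = (\<Sum>\<alpha>\<in>A. c \<alpha> \<sigma> * D \<alpha>)"
      using A(1) B(1) by (intro sum.mono_neutral_cong_right) auto
    moreover have "(\<Sum>\<alpha>\<in>A \<union> B. if \<alpha> \<in> B then d \<alpha> \<sigma> * D \<alpha> else 0) = (\<Sum>\<alpha>\<in>B. d \<alpha> \<sigma> * D \<alpha>)"
      using A(1) B(1) by (intro sum.mono_neutral_cong_right) auto
    ultimately show ?thesis by simp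
  qed
  then have "same_germ x (\<lambda>f \<sigma>. P f \<sigma> + Q f \<sigma>) (\<lambda>f \<sigma>. \<Sum>\<alpha>\<in>A \<union> B. e \<alpha> \<sigma> * pd_multi \<alpha> f \<sigma>)"
    using same_germ_add[OF P Q] by simp
  moreover have "e \<alpha> \<in> holo_germs x" for \<alpha>
    using A(3) B(3) by (cases "\<alpha> \<in> A"; cases "\<alpha> \<in> B") (auto simp: e_def[abs_def])
  ultimately show ?thesis using A B by (intro diffop_germsI[of "A \<union> B" e]) auto
qed

text \<open>Sorting the word yields a multi-index derivative. The two agree on holomorphic
  functions, which is what equality of germs tests.\<close>

lemma diffop_germs_pdl:
  assumes "set L \<subseteq> {1..CARD('k)}" shows "pdl L \<in> diffop_germs (x :: complex ^ 'k)"
proof -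
  let ?\<alpha> = "count (mset L)"
  have "same_germ x (pdl L) (\<lambda>f \<sigma>. \<Sum>\<alpha>\<in>{?\<alpha>}. 1 * pd_multi \<alpha> f \<sigma>)"
    by (rule same_germI)
       (simp add: pd_multi_eq_pdl pdl_mset_cong[OF _ _ _ mset_mlist_count[OF assms, symmetric] set_mlist])
  then show ?thesis
    using assms by (intro diffop_germsI[of "{?\<alpha>}" "\<lambda>_ _. 1"])
      (auto simp: multi_indices_def not_in_iff[symmetric])
qed

text \<open>Up to a power of \<open>gen s\<close>, the symbol is what the operator with coefficients \<open>c i\<close> in front
  of \<open>pdl (L i)\<close> makes of \<open>gen s \<sigma> powr (- \<mu>)\<close>, as a polynomial in \<open>s\<close>.\<close>

definition op_symbol ::
  "complex \<Rightarrow> nat \<Rightarrow> 'i set \<Rightarrow> ('i \<Rightarrow> complex ^ 'k \<Rightarrow> complex) \<Rightarrow> ('i \<Rightarrow> nat list) \<Rightarrow>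
     complex ^ 'k \<Rightarrow> complex poly" where
  "op_symbol \<mu> N I c L \<sigma> = (\<Sum>i\<in>I. monom (c i \<sigma> * pd_factor \<mu> (length (L i)) (sum_list (L i))) (sum_list (L i))
      * upoly \<sigma> ^ (N - length (L i)))"

text \<open>Since u^(-\<mu>-n) is u^(-\<mu>-N) times u^(N-n), all derivatives of order at most
  \<open>N\<close> share the first factor, and the rest is a polynomial in 1/a.\<close>

lemma sum_pdl_F_fun:
  fixes \<sigma> :: "complex ^ 'k"
  assumes "\<And>i. i \<in> I \<Longrightarrow> set (L i) \<subseteq> {1..CARD('k)} \<and> length (L i) \<le> N"
    and "a \<noteq> 0" "\<sigma> \<in> gen_dom (1 / a)"
  shows "(\<Sum>i\<in>I. c i \<sigma> * pdl (L i) (F_fun \<mu> a) \<sigma>)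
       = gen (1 / a) \<sigma> powr (- \<mu> - of_nat N) * poly (op_symbol \<mu> N I c L \<sigma>) (1 / a)"
  unfolding op_symbol_def poly_sum sum_distrib_left
proof (intro sum.cong refl)
  fix i assume i: "i \<in> I"
  let ?n = "length (L i)" and ?u = "gen (1 / a) \<sigma>"
  have u: "?u \<noteq> 0" by (rule gen_dom_nz[OF assms(3)])
  have "- \<mu> - of_nat ?n = (- \<mu> - of_nat N) + of_nat (N - ?n)"
    using assms(1)[OF i] by (simp add: of_nat_diff)
  then have "?u powr (- \<mu> - of_nat ?n) = ?u powr ((- \<mu> - of_nat N) + of_nat (N - ?n))"
    by (simp only:)
  also have "\<dots> = ?u powr (- \<mu> - of_nat N) * ?u ^ (N - ?n)"
    by (subst powr_add) (simp only: powr_nat'[OF disjI1[OF u]])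
  finally have "?u powr (- \<mu> - of_nat ?n) = ?u powr (- \<mu> - of_nat N) * ?u ^ (N - ?n)" .
  then show "c i \<sigma> * pdl (L i) (F_fun \<mu> a) \<sigma> = ?u powr (- \<mu> - of_nat N) *
      poly (monom (c i \<sigma> * pd_factor \<mu> ?n (sum_list (L i))) (sum_list (L i)) * upoly \<sigma> ^ (N - ?n)) (1 / a)"
    using assms(1)[OF i] by (simp add: pdl_F_fun[OF _ assms(2,3)] poly_monom poly_upoly)
qed

lemma sum_pdl_Phi:
  fixes \<sigma> :: "complex ^ 'k"
  assumes "\<And>i. i \<in> I \<Longrightarrow> set (L i) \<subseteq> {1..CARD('k)} \<and> length (L i) \<le> N"
  shows "(\<Sum>i\<in>I. c i \<sigma> * pdl (L i) (Phi \<mu> q) \<sigma>)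
       = fps_nth (fps_of_poly (op_symbol \<mu> N I c L \<sigma>) * Psi (\<mu> + of_nat N) \<sigma>) q"
  unfolding op_symbol_def fps_of_poly_sum sum_distrib_right fps_sum_nth
proof (intro sum.cong refl)
  fix i assume i: "i \<in> I"
  let ?n = "length (L i)" and ?w = "sum_list (L i)"
  have "\<mu> + of_nat ?n + of_nat (N - ?n) = \<mu> + of_nat N"
    using assms(1)[OF i] by (simp add: of_nat_diff)
  then have "Psi (\<mu> + of_nat ?n) \<sigma> = fps_of_poly (upoly \<sigma> ^ (N - ?n)) * Psi (\<mu> + of_nat N) \<sigma>"
    using Psi_shift[of "\<mu> + of_nat ?n" \<sigma> "N - ?n"] by (simp only:)
  then show "c i \<sigma> * pdl (L i) (Phi \<mu> q) \<sigma> = fps_nth (fps_of_poly (monom (c i \<sigma> * pd_factor \<mu> ?n ?w) ?w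
      * upoly \<sigma> ^ (N - ?n)) * Psi (\<mu> + of_nat N) \<sigma>) q"
    using assms(1)[OF i]
    by (simp add: pdl_Phi fps_of_poly_mult fps_of_poly_monom mult.assoc)
qed

text \<open>A word of length n has weight at most k * n, and u^(N-n) has degree at most k * (N-n),
  so the bound does not depend on n.\<close>

lemma degree_op_symbol:
  assumes "\<And>i. i \<in> I \<Longrightarrow> set (L i) \<subseteq> {1..CARD('k)} \<and> length (L i) \<le> N"
  shows "degree (op_symbol \<mu> N I c L (\<sigma> :: complex ^ 'k)) \<le> CARD('k) * N"
proof (cases "finite I")
  case True
  show ?thesis unfolding op_symbol_def
  proof (rule degree_sum_le[OF True])
    fix i assume i: "i \<in> I"
    let ?n = "length (L i)" and ?w = "sum_list (L i)"
    have "sum_list (map (\<lambda>h. h) (L i)) \<le> sum_list (map (\<lambda>_. CARD('k)) (L i))"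
      by (rule sum_list_mono) (use assms(1)[OF i] in auto)
    then have w: "?w \<le> CARD('k) * ?n" by (simp add: sum_list_triv mult.commute)
    have d: "degree (upoly \<sigma> ^ (N - ?n)) \<le> CARD('k) * (N - ?n)"
      using degree_power_le[of "upoly \<sigma>" "N - ?n"] degree_upoly[of \<sigma>]
      by (meson mult_le_mono1 order_trans)
    have e: "CARD('k) * ?n + CARD('k) * (N - ?n) = CARD('k) * N"
      using assms(1)[OF i] by (simp add: distrib_left[symmetric])
    have m: "degree (monom b ?w * upoly \<sigma> ^ (N - ?n)) \<le> ?w + degree (upoly \<sigma> ^ (N - ?n))" for b
      using degree_mult_le[of "monom b ?w"] degree_monom_le[of b ?w] by (meson add_le_mono1 order_trans)
    show "degree (monom (c i \<sigma> * pd_factor \<mu> ?n ?w) ?w * upoly \<sigma> ^ (N - ?n)) \<le> CARD('k) * N"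
      by (rule order_trans[OF m]) (use w d e in linarith)
  qed
qed (simp add: op_symbol_def)

section \<open>Annihilation expressed through the symbol\<close>

lemma fps_mult_nth_subdegree:
  fixes f g :: "'b::ring_1 fps"
  shows "fps_nth (f * g) (subdegree f) = fps_nth f (subdegree f) * fps_nth g 0"
proof -
  have "(\<Sum>i\<in>{0..subdegree f} - {subdegree f}. fps_nth f i * fps_nth g (subdegree f - i)) = 0"
    by (rule sum.neutral) (auto simp: nth_less_subdegree_zero)
  then show ?thesis by (simp add: fps_mult_nth sum.remove[of "{0..subdegree f}" "subdegree f"])
qed

text \<open>Covers both expansions of an arbitrary operator, indexed by multi-indices, and
  combinations of normal forms, indexed by the weight.\<close>

locale pdl_representation =
  fixes x :: "complex ^ 'k" and P :: "'k operator" and I :: "'i set"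
    and c :: "'i \<Rightarrow> complex ^ 'k \<Rightarrow> complex" and L :: "'i \<Rightarrow> nat list" and N :: nat
  assumes rep: "same_germ x P (\<lambda>f \<sigma>. \<Sum>i\<in>I. c i \<sigma> * pdl (L i) f \<sigma>)"
    and lists: "\<And>i. i \<in> I \<Longrightarrow> set (L i) \<subseteq> {1..CARD('k)} \<and> length (L i) \<le> N"
begin

text \<open>The power of \<open>gen\<close> split off in \<open>sum_pdl_F_fun\<close> has no zeros
  on \<open>gen_dom\<close>, so only the value of the symbol at 1/a matters.\<close>

lemma kills_F_fun_iff:
  assumes "a \<noteq> 0" "x \<in> gen_dom (1 / a)"
  shows "kills x P (F_fun \<mu> a)
     \<longleftrightarrow> eventually (\<lambda>\<sigma>. poly (op_symbol \<mu> N I c L \<sigma>) (1 / a) = 0) (nhds x)"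
proof -
  from rep obtain U where U: "open U" "x \<in> U" "\<And>V f \<sigma>. open V \<Longrightarrow> V \<subseteq> U \<Longrightarrow> holo_on V f \<Longrightarrow>
      \<sigma> \<in> V \<Longrightarrow> P f \<sigma> = (\<Sum>i\<in>I. c i \<sigma> * pdl (L i) f \<sigma>)"
    by (rule same_germE) blast
  have eq: "P (F_fun \<mu> a) \<sigma> = 0 \<longleftrightarrow> poly (op_symbol \<mu> N I c L \<sigma>) (1 / a) = 0"
    if "\<sigma> \<in> U \<inter> gen_dom (1 / a)" for \<sigma>
  proof -
    have "P (F_fun \<mu> a) \<sigma> = (\<Sum>i\<in>I. c i \<sigma> * pdl (L i) (F_fun \<mu> a) \<sigma>)"
      by (rule U(3)[of "U \<inter> gen_dom (1 / a)"])
         (use U(1) that in \<open>auto intro: open_gen_dom holo_on_subset[OF holo_on_F_fun[OF assms(1)]]\<close>)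
    also have "\<dots> = gen (1 / a) \<sigma> powr (- \<mu> - of_nat N) * poly (op_symbol \<mu> N I c L \<sigma>) (1 / a)"
      by (rule sum_pdl_F_fun[OF lists assms(1)]) (use that in auto)
    finally show ?thesis using that gen_dom_nz[of \<sigma> "1 / a"] by simp
  qed
  have ev: "eventually (\<lambda>\<sigma>. \<sigma> \<in> U \<inter> gen_dom (1 / a)) (nhds x)"
    using U assms(2) by (intro eventually_nhds_in_open) (auto intro: open_gen_dom)
  show ?thesis unfolding kills_def
    by (rule eventually_subst[OF eventually_mono[OF ev eq]])
qed

text \<open>The neighbourhood on which \<open>F_fun \<mu> a\<close> is killed depends on
  \<open>a\<close>, so only finitely many values can be used together. One more than the degree
  bound suffices: a nonzero symbol would have too many roots.\<close>

lemma kills_all_F_fun_iff: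
  "(\<exists>r. \<forall>a. cmod a > r \<longrightarrow> kills x P (F_fun \<mu> a))
     \<longleftrightarrow> eventually (\<lambda>\<sigma>. op_symbol \<mu> N I c L \<sigma> = 0) (nhds x)"
proof
  obtain r0 where "r0 > 0 \<and> (\<forall>a. cmod a > r0 \<longrightarrow> x \<in> gen_dom (1 / a))"
    using eventually_mem_gen_dom[of x] by (rule exE)
  then have r0: "r0 > 0" "cmod a > r0 \<Longrightarrow> x \<in> gen_dom (1 / a)" for a by simp_all
  let ?S = "op_symbol \<mu> N I c L" and ?M = "CARD('k) * N"
  show "\<exists>r. \<forall>a. cmod a > r \<longrightarrow> kills x P (F_fun \<mu> a)" if "eventually (\<lambda>\<sigma>. ?S \<sigma> = 0) (nhds x)"
  proof (intro exI[of _ r0] allI impI)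
    fix a assume "cmod a > r0"
    with r0 have a: "a \<noteq> 0" "x \<in> gen_dom (1 / a)" by auto
    have "eventually (\<lambda>\<sigma>. poly (?S \<sigma>) (1 / a) = 0) (nhds x)"
      by (rule eventually_mono[OF that]) simp
    then show "kills x P (F_fun \<mu> a)" by (simp only: kills_F_fun_iff[OF a])
  qed
  have deg: "degree (?S \<sigma>) \<le> ?M" for \<sigma> by (rule degree_op_symbol[OF lists])
  assume "\<exists>r. \<forall>a. cmod a > r \<longrightarrow> kills x P (F_fun \<mu> a)"
  then obtain r where r: "\<And>a. cmod a > r \<Longrightarrow> kills x P (F_fun \<mu> a)" by blast
  \<comment> \<open>Distinct points beyond both radii: the first makes the function killed, the
    second puts \<open>x\<close> into its domain.\<close>
  define a :: "nat \<Rightarrow> complex" where "a j = of_real (max r r0 + 1 + of_nat j)" for j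
  have a: "cmod (a j) > r" "cmod (a j) > r0" "a j \<noteq> 0" for j
  proof -
    have "cmod (a j) = max r r0 + 1 + of_nat j"
      unfolding a_def norm_of_real using r0(1) by simp
    then show "cmod (a j) > r" "cmod (a j) > r0" by linarith+
    then show "a j \<noteq> 0" using r0(1) by auto
  qed
  have inj: "inj_on (\<lambda>j. 1 / a j) {..?M}"
    by (rule inj_onI) (simp add: a_def del: of_real_add)
  have ev: "eventually (\<lambda>\<sigma>. poly (?S \<sigma>) (1 / a j) = 0) (nhds x)" for j
    using kills_F_fun_iff[OF a(3) r0(2)[OF a(2)]] r[OF a(1)] by blast
  have "eventually (\<lambda>\<sigma>. \<forall>j\<in>{..?M}. poly (?S \<sigma>) (1 / a j) = 0) (nhds x)"
    by (intro eventually_ball_finite finite_atMost ballI ev)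
  then show "eventually (\<lambda>\<sigma>. ?S \<sigma> = 0) (nhds x)"
  proof (rule eventually_mono)
    fix \<sigma> assume 0: "\<forall>j\<in>{..?M}. poly (?S \<sigma>) (1 / a j) = 0"
    show "?S \<sigma> = 0"
    proof (rule ccontr)
      assume nz: "?S \<sigma> \<noteq> 0"
      have "card ((\<lambda>j. 1 / a j) ` {..?M}) \<le> card {z. poly (?S \<sigma>) z = 0}"
        using 0 by (intro card_mono poly_roots_finite nz) auto
      then show False
        using card_poly_roots_bound[OF nz] deg[of \<sigma>]
        by (simp add: card_image[OF inj])
    qed
  qed
qed

lemma kills_Phi_iff:
  "kills x P (Phi \<mu> q) \<longleftrightarrow> eventually (\<lambda>\<sigma>. fps_nth (fps_of_poly (op_symbol \<mu> N I c L \<sigma>)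
      * Psi (\<mu> + of_nat N) \<sigma>) q = 0) (nhds x)"
proof -
  from rep obtain U where U: "open U" "x \<in> U" "\<And>V f \<sigma>. open V \<Longrightarrow> V \<subseteq> U \<Longrightarrow> holo_on V f \<Longrightarrow>
      \<sigma> \<in> V \<Longrightarrow> P f \<sigma> = (\<Sum>i\<in>I. c i \<sigma> * pdl (L i) f \<sigma>)"
    by (rule same_germE) blast
  have eq: "(P (Phi \<mu> q) \<sigma> = 0) = ( fps_nth (fps_of_poly (op_symbol \<mu> N I c L \<sigma>)
      * Psi (\<mu> + of_nat N) \<sigma>) q = 0)" if "\<sigma> \<in> U" for \<sigma>
    unfolding U(3)[OF U(1) order_refl holo_on_Phi that] by (subst sum_pdl_Phi[OF lists]) auto
  have ev: "eventually (\<lambda>\<sigma>. \<sigma> \<in> U) (nhds x)"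
    using U by (intro eventually_nhds_in_open)
  show ?thesis unfolding kills_def
    by (rule eventually_subst[OF eventually_mono[OF ev eq]])
qed

text \<open>The first nonzero coefficient of the symbol, whose index is at most its degree, would
  reappear unchanged in the product with \<open>Psi\<close>. Hence finitely many \<open>q\<close>
  suffice, and their neighbourhoods can be intersected.\<close>

lemma kills_all_Phi_iff:
  "(\<forall>q. kills x P (Phi \<mu> q)) \<longleftrightarrow> eventually (\<lambda>\<sigma>. op_symbol \<mu> N I c L \<sigma> = 0) (nhds x)"
proof
  let ?S = "op_symbol \<mu> N I c L" and ?M = "CARD('k) * N"
  show "\<forall>q. kills x P (Phi \<mu> q)" if "eventually (\<lambda>\<sigma>. ?S \<sigma> = 0) (nhds x)"
  proof
    fix q
    have "eventually (\<lambda>\<sigma>. fps_nth (fps_of_poly (?S \<sigma>) * Psi (\<mu> + of_nat N) \<sigma>) q = 0) (nhds x)"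
      by (rule eventually_mono[OF that]) simp
    then show "kills x P (Phi \<mu> q)" by (simp only: kills_Phi_iff)
  qed
  have deg: "degree (?S \<sigma>) \<le> ?M" for \<sigma> by (rule degree_op_symbol[OF lists])
  assume *: "\<forall>q. kills x P (Phi \<mu> q)"
  have "eventually (\<lambda>\<sigma>. \<forall>q\<in>{..?M}. fps_nth (fps_of_poly (?S \<sigma>) * Psi (\<mu> + of_nat N) \<sigma>) q = 0) (nhds x)"
    by (intro eventually_ball_finite finite_atMost ballI) (rule *[unfolded kills_Phi_iff, THEN spec])
  then show "eventually (\<lambda>\<sigma>. ?S \<sigma> = 0) (nhds x)"
  proof (rule eventually_mono)
    fix \<sigma> assume 0: "\<forall>q\<in>{..?M}. fps_nth (fps_of_poly (?S \<sigma>) * Psi (\<mu> + of_nat N) \<sigma>) q = 0"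
    show "?S \<sigma> = 0"
    proof (rule ccontr)
      assume nz: "?S \<sigma> \<noteq> 0"
      let ?f = "fps_of_poly (?S \<sigma>)"
      have "?f \<noteq> 0" using nz by simp
      then have f: "fps_nth ?f (subdegree ?f) \<noteq> 0" by (rule nth_subdegree_nonzero)
      then have "subdegree ?f \<le> degree (?S \<sigma>)" by (simp add: le_degree)
      then have "subdegree ?f \<le> ?M"
        using deg[of \<sigma>] by simp
      then have "fps_nth (?f * Psi (\<mu> + of_nat N) \<sigma>) (subdegree ?f) = 0"
        by (intro bspec[OF 0]) simp
      then show False
        using f by (simp only: fps_mult_nth_subdegree Psi_nth_0 mult_1_right)
    qed
  qed
qed

end

lemma diffop_germs_obtain_representation:
  assumes "P \<in> diffop_germs (x :: complex ^ 'k)"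
  obtains A c N where "finite A" "\<And>\<alpha>. \<alpha> \<in> A \<Longrightarrow> c \<alpha> \<in> holo_germs x"
    "pdl_representation x P A c (mlist CARD('k)) N"
proof -
  from assms obtain A c where A: "finite A" "A \<subseteq> multi_indices CARD('k)"
    "\<And>\<alpha>. \<alpha> \<in> A \<Longrightarrow> c \<alpha> \<in> holo_germs x"
    and P: "same_germ x P (\<lambda>f \<sigma>. \<Sum>\<alpha>\<in>A. c \<alpha> \<sigma> * pd_multi \<alpha> f \<sigma>)"
    by (rule diffop_germsE) blast
  \<comment> \<open>The sum of all orders serves as a common bound for each of them.\<close>
  have "pdl_representation x P A c (mlist CARD('k)) (\<Sum>\<alpha>\<in>A. length (mlist CARD('k) \<alpha>))"
    using P set_mlist A(1)
    by unfold_locales (auto simp: pd_multi_eq_pdl intro!: member_le_sum dest: subsetD)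
  with that A show ?thesis by blast
qed

text \<open>Both conditions say that one and the same symbol vanishes near \<open>x\<close>.\<close>

lemma ann_F_eq_ann_Phi: "ann_F \<mu> x = ann_Phi \<mu> x"
proof -
  have "(\<exists>r. \<forall>a. cmod a > r \<longrightarrow> kills x P (F_fun \<mu> a)) \<longleftrightarrow> (\<forall>q. kills x P (Phi \<mu> q))"
    if "P \<in> diffop_germs x" for P
    using that
  proof (rule diffop_germs_obtain_representation)
    fix A c N assume "pdl_representation x P A c (mlist CARD('a)) N"
    then interpret pdl_representation x P A c "mlist CARD('a)" N .
    show ?thesis using kills_all_F_fun_iff[of \<mu>] kills_all_Phi_iff[of \<mu>] by simp
  qed
  then show ?thesis unfolding ann_F_def ann_Phi_def by blast
qed

section \<open>The left ideal\<close>

definition left_comb ::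
  "complex \<Rightarrow> (nat \<Rightarrow> nat \<Rightarrow> 'k operator) \<Rightarrow> (nat \<Rightarrow> 'k operator) \<Rightarrow> 'k::finite operator" where
  "left_comb \<mu> Q R f \<sigma> = (\<Sum>p=1..CARD('k) - 1. \<Sum>q=2..CARD('k). Q p q (A_op p q f) \<sigma>) +
     (\<Sum>m=2..CARD('k). R m (T_op \<mu> m f) \<sigma>)"

text \<open>The ideal condition is separated from membership in \<open>diffop_germs\<close>, so that
  its closure properties apply to arbitrary representatives.\<close>

definition in_ideal :: "complex \<Rightarrow> complex ^ 'k \<Rightarrow> 'k operator \<Rightarrow> bool" where
  "in_ideal \<mu> x P \<longleftrightarrow> (\<exists>Q R.
        (\<forall>p\<in>{1..CARD('k) - 1}. \<forall>q\<in>{2..CARD('k)}. Q p q \<in> diffop_germs x) \<and>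
        (\<forall>m\<in>{2..CARD('k)}. R m \<in> diffop_germs x) \<and> same_germ x P (left_comb \<mu> Q R))"

lemma ideal_germs_eq: "ideal_germs \<mu> x = {P \<in> diffop_germs x. in_ideal \<mu> x P}"
  by (simp add: ideal_germs_def in_ideal_def left_comb_def[abs_def])

lemma in_idealI:
  fixes x :: "complex ^ 'k"
  assumes "\<And>p q. p \<in> {1..CARD('k) - 1} \<Longrightarrow> q \<in> {2..CARD('k)} \<Longrightarrow> Q p q \<in> diffop_germs x"
    and "\<And>m. m \<in> {2..CARD('k)} \<Longrightarrow> R m \<in> diffop_germs x"
    and "same_germ x P (left_comb \<mu> Q R)"
  shows "in_ideal \<mu> x P"
  unfolding in_ideal_def by (intro exI[of _ Q] exI[of _ R] conjI ballI assms)

lemma in_idealE: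
  fixes x :: "complex ^ 'k"
  assumes "in_ideal \<mu> x P"
  obtains Q R where "\<forall>p\<in>{1..CARD('k) - 1}. \<forall>q\<in>{2..CARD('k)}. Q p q \<in> diffop_germs x"
    "\<forall>m\<in>{2..CARD('k)}. R m \<in> diffop_germs x" "same_germ x P (left_comb \<mu> Q R)"
  using assms unfolding in_ideal_def by (elim exE conjE) (rule that)

lemma in_ideal_cong: "in_ideal \<mu> x P \<Longrightarrow> same_germ x P' P \<Longrightarrow> in_ideal \<mu> x P'"
  unfolding in_ideal_def by (blast intro: same_germ_trans)

lemma in_ideal_eqI: "in_ideal \<mu> x P \<Longrightarrow> (\<And>f \<sigma>. P' f \<sigma> = P f \<sigma>) \<Longrightarrow> in_ideal \<mu> x P'"
  by (erule in_ideal_cong) (rule same_germI)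

lemma in_ideal_zero: "in_ideal \<mu> x (\<lambda>f \<sigma>. 0)"
  by (rule in_idealI[of "\<lambda>p q f \<sigma>. 0" _ "\<lambda>m f \<sigma>. 0"])
     (simp_all add: diffop_germs_zero left_comb_def[abs_def] same_germ_refl)

lemma in_ideal_add:
  assumes "in_ideal \<mu> x P" "in_ideal \<mu> x P'"
  shows "in_ideal \<mu> x (\<lambda>f \<sigma>. P f \<sigma> + P' f \<sigma>)"
proof -
  from assms(1) obtain Q R where Q: "\<forall>p\<in>{1..CARD('a) - 1}. \<forall>q\<in>{2..CARD('a)}. Q p q \<in> diffop_germs x"
    "\<forall>m\<in>{2..CARD('a)}. R m \<in> diffop_germs x" and P: "same_germ x P (left_comb \<mu> Q R)"
    by (rule in_idealE)
  from assms(2) obtain Q' R' where Q': "\<forall>p\<in>{1..CARD('a) - 1}. \<forall>q\<in>{2..CARD('a)}. Q' p q \<in> diffop_germs x"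
    "\<forall>m\<in>{2..CARD('a)}. R' m \<in> diffop_germs x" and P': "same_germ x P' (left_comb \<mu> Q' R')"
    by (rule in_idealE)
  have eq: "left_comb \<mu> (\<lambda>p q f \<sigma>. Q p q f \<sigma> + Q' p q f \<sigma>) (\<lambda>m f \<sigma>. R m f \<sigma> + R' m f \<sigma>)
      = (\<lambda>f \<sigma>. left_comb \<mu> Q R f \<sigma> + left_comb \<mu> Q' R' f \<sigma>)"
    by (simp add: left_comb_def fun_eq_iff sum.distrib)
  show ?thesis
    by (rule in_idealI[of "\<lambda>p q f \<sigma>. Q p q f \<sigma> + Q' p q f \<sigma>" _ "\<lambda>m f \<sigma>. R m f \<sigma> + R' m f \<sigma>"])
       (use Q Q' in \<open>simp_all add: diffop_germs_add eq same_germ_add[OF P P']\<close>)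
qed

lemma in_ideal_cmult:
  assumes "in_ideal \<mu> x P" "c \<in> holo_germs x"
  shows "in_ideal \<mu> x (\<lambda>f \<sigma>. c \<sigma> * P f \<sigma>)"
proof -
  from assms(1) obtain Q R where Q: "\<forall>p\<in>{1..CARD('a) - 1}. \<forall>q\<in>{2..CARD('a)}. Q p q \<in> diffop_germs x"
    "\<forall>m\<in>{2..CARD('a)}. R m \<in> diffop_germs x" and P: "same_germ x P (left_comb \<mu> Q R)"
    by (rule in_idealE)
  have eq: "left_comb \<mu> (\<lambda>p q f \<sigma>. c \<sigma> * Q p q f \<sigma>) (\<lambda>m f \<sigma>. c \<sigma> * R m f \<sigma>)
      = (\<lambda>f \<sigma>. c \<sigma> * left_comb \<mu> Q R f \<sigma>)"
    by (simp add: left_comb_def fun_eq_iff sum_distrib_left distrib_left)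
  show ?thesis
    by (rule in_idealI[of "\<lambda>p q f \<sigma>. c \<sigma> * Q p q f \<sigma>" _ "\<lambda>m f \<sigma>. c \<sigma> * R m f \<sigma>"])
       (use Q assms(2) in \<open>simp_all add: diffop_germs_cmult eq same_germ_cmult[OF P]\<close>)
qed

lemma in_ideal_diff:
  assumes "in_ideal \<mu> x P" "in_ideal \<mu> x Q"
  shows "in_ideal \<mu> x (\<lambda>f \<sigma>. P f \<sigma> - Q f \<sigma>)"
  by (rule in_ideal_eqI[OF in_ideal_add[OF assms(1) in_ideal_cmult[OF assms(2) holo_germs_const[of "-1"]]]])
     simp

text \<open>The family of left coefficients is concentrated at the single generator with indices
  \<open>p\<close>, \<open>q\<close>.\<close>

lemma in_ideal_pdl_A:
  assumes "set L \<subseteq> {1..CARD('k)}" "p \<in> {1..CARD('k) - 1}" "q \<in> {2..CARD('k)}"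
  shows "in_ideal \<mu> (x :: complex ^ 'k) (\<lambda>f. pdl L (A_op p q f))"
proof (rule in_idealI[of "\<lambda>p' q' f \<sigma>. if p' = p \<and> q' = q then pdl L f \<sigma> else 0" _ "\<lambda>m f \<sigma>. 0"])
  fix p' q'
  show "(\<lambda>f \<sigma>. if p' = p \<and> q' = q then pdl L f \<sigma> else 0) \<in> diffop_germs x"
    by (cases "p' = p \<and> q' = q") (auto intro: diffop_germs_zero diffop_germs_pdl[OF assms(1)])
next
  have "(\<Sum>p'=1..CARD('k) - 1. \<Sum>q'=2..CARD('k).
      if p' = p \<and> q' = q then pdl L (A_op p' q' f) \<sigma> else 0) = pdl L (A_op p q f) \<sigma>"
    for f and \<sigma> :: "complex ^ 'k"
  proof -
    have "(\<Sum>p'=1..CARD('k) - 1. \<Sum>q'=2..CARD('k). if p' = p \<and> q' = q then pdl L (A_op p' q' f) \<sigma> else 0)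
      = (\<Sum>p'=1..CARD('k) - 1. if p' = p then
          (\<Sum>q'=2..CARD('k). if q' = q then pdl L (A_op p q' f) \<sigma> else 0) else 0)"
      by (intro sum.cong) auto
    then show ?thesis using assms(2,3) by simp
  qed
  then show "same_germ x (\<lambda>f. pdl L (A_op p q f))
      (left_comb \<mu> (\<lambda>p' q' f \<sigma>. if p' = p \<and> q' = q then pdl L f \<sigma> else 0) (\<lambda>m f \<sigma>. 0))"
    by (intro same_germI) (simp add: left_comb_def)
qed (rule diffop_germs_zero)

lemma in_ideal_pdl_T:
  assumes "set L \<subseteq> {1..CARD('k)}" "m \<in> {2..CARD('k)}"
  shows "in_ideal \<mu> (x :: complex ^ 'k) (\<lambda>f. pdl L (T_op \<mu> m f))"
proof (rule in_idealI[of "\<lambda>p' q' f \<sigma>. 0" _ "\<lambda>m' f \<sigma>. if m' = m then pdl L f \<sigma> else 0"])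
  fix m'
  show "(\<lambda>f \<sigma>. if m' = m then pdl L f \<sigma> else 0) \<in> diffop_germs x"
    by (cases "m' = m") (auto intro: diffop_germs_zero diffop_germs_pdl[OF assms(1)])
next
  show "same_germ x (\<lambda>f. pdl L (T_op \<mu> m f))
      (left_comb \<mu> (\<lambda>p' q' f \<sigma>. 0) (\<lambda>m' f \<sigma>. if m' = m then pdl L f \<sigma> else 0))"
    using assms(2) by (intro same_germI) (simp add: left_comb_def)
qed (rule diffop_germs_zero)

section \<open>Congruence of derivatives modulo the operators A\<close>

definition pdl_equiv :: "complex \<Rightarrow> complex ^ 'k \<Rightarrow> nat list \<Rightarrow> nat list \<Rightarrow> bool" where
  "pdl_equiv \<mu> x L M \<longleftrightarrow> in_ideal \<mu> x (\<lambda>f \<sigma>. pdl L f \<sigma> - pdl M f \<sigma>)"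

lemma pdl_equiv_refl: "pdl_equiv \<mu> x L L"
  by (simp add: pdl_equiv_def in_ideal_zero)

lemma pdl_equiv_sym: "pdl_equiv \<mu> x L M \<Longrightarrow> pdl_equiv \<mu> x M L"
  unfolding pdl_equiv_def by (rule in_ideal_eqI[OF in_ideal_diff[OF in_ideal_zero]]) auto

lemma pdl_equiv_trans [trans]: "pdl_equiv \<mu> x L M \<Longrightarrow> pdl_equiv \<mu> x M K \<Longrightarrow> pdl_equiv \<mu> x L K"
  unfolding pdl_equiv_def by (drule (1) in_ideal_add) (erule in_ideal_eqI, simp)

lemma pdl_equiv_mset:
  assumes "mset L = mset M" "set M \<subseteq> {1..CARD('k)}"
  shows "pdl_equiv \<mu> (x :: complex ^ 'k) L M"
  unfolding pdl_equiv_def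
  by (rule in_ideal_cong[OF in_ideal_zero], rule same_germI)
     (simp add: pdl_mset_cong[OF _ _ _ assms])

text \<open>In a left ideal the generator acts first, so the rewritten pair stands at the end of the
  word; other pairs are brought there by \<open>pdl_equiv_mset\<close>.\<close>

lemma pdl_equiv_swap_step:
  assumes "set L \<subseteq> {1..CARD('k)}" "p \<in> {1..CARD('k) - 1}" "q \<in> {2..CARD('k)}"
  shows "pdl_equiv \<mu> (x :: complex ^ 'k) (L @ [p, q]) (L @ [p + 1, q - 1])"
  unfolding pdl_equiv_def
proof (rule in_ideal_cong[OF in_ideal_pdl_A[OF assms]], rule same_germI)
  fix V :: "(complex ^ 'k) set" and f \<sigma> assume V: "open V" "holo_on V f" "\<sigma> \<in> V"
  have "A_op p q f = (\<lambda>\<sigma>. pdl [p, q] f \<sigma> - pdl [p + 1, q - 1] f \<sigma>)"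
    by (simp add: A_op_def fun_eq_iff)
  then show "pdl (L @ [p, q]) f \<sigma> - pdl (L @ [p + 1, q - 1]) f \<sigma> = pdl L (A_op p q f) \<sigma>"
    by (simp only: pdl_simps(3) pdl_diff[OF V(1) holo_on_pdl[OF V(1,2)] holo_on_pdl[OF V(1,2)] V(3)])
qed

lemma pdl_equiv_shift:
  assumes "set L \<subseteq> {1..CARD('k)}" "p \<ge> 1" "q \<le> CARD('k)" "p + d \<le> CARD('k)" "d < q"
  shows "pdl_equiv \<mu> (x :: complex ^ 'k) (L @ [p, q]) (L @ [p + d, q - d])"
  using assms(4,5)
proof (induction d)
  case (Suc d)
  have "pdl_equiv \<mu> x (L @ [p, q]) (L @ [p + d, q - d])" using Suc by simp
  also have "pdl_equiv \<mu> x \<dots> (L @ [(p + d) + 1, (q - d) - 1])"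
    by (rule pdl_equiv_swap_step) (use assms Suc.prems in auto)
  finally show ?case by simp
qed (simp add: pdl_equiv_refl)

text \<open>Unit steps lead from one pair to any other with the same sum in the direction of
  increasing first letter; symmetry gives the other direction.\<close>

lemma pdl_equiv_swap:
  assumes "set L \<subseteq> {1..CARD('k)}" "{p, q, p', q'} \<subseteq> {1..CARD('k)}" "p + q = p' + q'"
  shows "pdl_equiv \<mu> (x :: complex ^ 'k) (L @ [p, q]) (L @ [p', q'])"
proof (cases "p \<le> p'")
  case True
  have "q - (p' - p) = q'" "p' - p < q" using True assms(2,3) by auto
  with True assms pdl_equiv_shift[OF assms(1), of p q "p' - p" \<mu> x] show ?thesis by simp
next
  case False
  then have "q' - (p - p') = q" "p - p' < q'" using assms(2,3) by auto
  with False assms pdl_equiv_shift[OF assms(1), of p' q' "p - p'" \<mu> x] have "pdl_equiv \<mu> x (L @ [p', q']) (L @ [p, q])"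
    by simp
  then show ?thesis by (rule pdl_equiv_sym)
qed

text \<open>A canonical word of length n and sum w: each letter is the least one for which the
  remaining letters, at most k each, can still make up the rest.\<close>

fun greedy_list :: "nat \<Rightarrow> nat \<Rightarrow> nat \<Rightarrow> nat list" where
  "greedy_list k 0 w = []"
| "greedy_list k (Suc n) w = max 1 (w - k * n) # greedy_list k n (w - max 1 (w - k * n))"

lemma greedy_list_props:
  assumes "k \<ge> 1" "n \<le> w" "w \<le> k * n"
  shows "length (greedy_list k n w) = n" "sum_list (greedy_list k n w) = w" "set (greedy_list k n w) \<subseteq> {1..k}"
proof -
  have "length (greedy_list k n w) = n \<and> sum_list (greedy_list k n w) = w \<and> set (greedy_list k n w) \<subseteq> {1..k}"
    using assms(2,3)
  proof (induction n arbitrary: w)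
    case (Suc n)
    define K where "K = k * n"
    define h where "h = max 1 (w - K)"
    have "n \<le> K" "w \<le> k + K" using assms(1) Suc.prems by (simp_all add: K_def)
    with Suc.prems(1) assms(1) have h: "1 \<le> h" "h \<le> k" "n \<le> w - h" "w - h \<le> K" "h \<le> w"
      unfolding h_def max_def by (auto split: if_splits)
    have "greedy_list k (Suc n) w = h # greedy_list k n (w - h)" by (simp add: h_def K_def)
    with Suc.IH[OF h(3)] h show ?case by (auto simp: K_def simp del: greedy_list.simps)
  qed simp
  then show "length (greedy_list k n w) = n" "sum_list (greedy_list k n w) = w" "set (greedy_list k n w) \<subseteq> {1..k}" by auto
qed

lemma sum_list_bounds:
  assumes "set L \<subseteq> {1..k}"
  shows "length L \<le> sum_list L" "sum_list L \<le> k * length L"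
  using assms by (induction L) auto

text \<open>After the tail is normalised, the head \<open>p\<close> is at least the greedy head
  \<open>h\<close>. Any excess is passed on to the next letter, and the tail is normalised once
  more. The prefix \<open>M\<close> lets the induction hypothesis act on tails.\<close>

lemma pdl_equiv_greedy_list:
  assumes "set M \<subseteq> {1..CARD('k)}" "set L \<subseteq> {1..CARD('k)}"
  shows "pdl_equiv \<mu> (x :: complex ^ 'k) (M @ L) (M @ greedy_list CARD('k) (length L) (sum_list L))"
proof -
  define k where "k = CARD('k)"
  have k: "k \<ge> 1" unfolding k_def by (simp add: Suc_leI)
  have "pdl_equiv \<mu> x (M @ L) (M @ greedy_list k n (sum_list L))"
    if "length L = n" "set M \<subseteq> {1..k}" "set L \<subseteq> {1..k}" for n
    using that
  proof (induction n arbitrary: M L)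
    case (Suc n)
    then obtain p L' where L: "L = p # L'" "length L' = n" by (cases L) auto
    define w where "w = sum_list L"
    define K where "K = k * n"
    define h where "h = max 1 (w - K)"
    have p: "1 \<le> p" "p \<le> k" and L': "set L' \<subseteq> {1..k}" using Suc.prems L by auto
    have w: "w - p = sum_list L'" "p \<le> w" unfolding w_def L by auto
    have kn: "n \<le> K" using k by (simp add: K_def)
    have b: "n \<le> w - p" "w - p \<le> K" using sum_list_bounds[OF L'] L w by (auto simp: K_def)
    have h: "1 \<le> h" "h \<le> p" "h \<le> k" "n \<le> w - h" "w - h \<le> K"
      using b p w(2) kn unfolding h_def max_def by (auto split: if_splits)
    have "pdl_equiv \<mu> x (M @ L) ((M @ [p]) @ greedy_list k n (w - p))"
      using Suc.IH[of L' "M @ [p]"] Suc.prems L w L' by simp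
    also have "pdl_equiv \<mu> x \<dots> (M @ h # greedy_list k n (w - h))"
    proof (cases "p = h")
      case True
      then show ?thesis by (simp add: pdl_equiv_refl)
    next
      case False
      with h have ph: "h < p" by simp
      \<comment> \<open>A single letter is determined by the weight, so with an empty tail
        \<open>p\<close> would equal \<open>h\<close>.\<close>
      have "n \<noteq> 0"
      proof
        assume "n = 0"
        then show False using b(2) w(2) ph by (simp add: h_def K_def)
      qed
      then obtain n' where n: "n = Suc n'" using not0_implies_Suc by blast
      define K' where "K' = k * n'"
      define q where "q = max 1 (w - p - K')"
      define C where "C = greedy_list k n' (w - p - q)"
      define r where "r = p + q - h"
      have K: "K = k + K'" unfolding n K_def K'_def by simp
      have kn': "n' \<le> K'" using k by (simp add: K'_def)
      have q: "1 \<le> q" "q \<le> k" "n' \<le> w - p - q" "w - p - q \<le> K'" "q \<le> w - p"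
        using b kn' k unfolding q_def K n max_def by (auto split: if_splits)
      \<comment> \<open>The new letter \<open>r\<close> must not exceed \<open>k\<close>. If
        \<open>q = 1\<close>, then \<open>r\<close> is at most \<open>p\<close>; otherwise
        \<open>r = w - K' - h\<close>, and the choice of \<open>h\<close> bounds it.\<close>
      have "w \<le> h + (k + K')" by (simp add: h_def K)
      moreover have "q = 1 \<or> q + p + K' = w" using w(2) by (auto simp: q_def max_def)
      ultimately have r: "1 \<le> r" "r \<le> k"
        using ph q(1) p(2) h(1) unfolding r_def by linarith+
      note C = greedy_list_props[OF k q(3) q(4)[unfolded K'_def], folded C_def]
      have "greedy_list k n (w - p) = q # C" by (simp add: n q_def C_def K'_def)
      \<comment> \<open>The pair to be exchanged is moved to the end, where the generators
        act.\<close>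
      moreover have "pdl_equiv \<mu> x ((M @ [p]) @ q # C) ((M @ C) @ [p, q])"
        using Suc.prems C p q
        by (intro pdl_equiv_mset) (auto simp: k_def[symmetric])
      ultimately have "pdl_equiv \<mu> x ((M @ [p]) @ greedy_list k n (w - p)) ((M @ C) @ [p, q])" by simp
      also have "pdl_equiv \<mu> x \<dots> ((M @ C) @ [h, r])"
        using Suc.prems C p q h r ph by (intro pdl_equiv_swap) (auto simp: r_def k_def[symmetric])
      also have "pdl_equiv \<mu> x \<dots> ((M @ [h]) @ (r # C))"
        using Suc.prems C h r by (intro pdl_equiv_mset) (auto simp: k_def[symmetric])
      also have "pdl_equiv \<mu> x \<dots> ((M @ [h]) @ greedy_list k n (sum_list (r # C)))"
        using Suc.prems C h r n by (intro Suc.IH) auto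
      also have "sum_list (r # C) = w - h" using C q w ph unfolding r_def by simp
      finally show ?thesis by simp
    qed
    finally show ?case by (simp add: h_def w_def K_def)
  qed (simp add: pdl_equiv_refl)
  with assms show ?thesis by (simp add: k_def)
qed

section \<open>Commutation with the Euler field\<close>

lemma holo_on_euler_op:
  fixes f :: "complex ^ 'k \<Rightarrow> complex"
  assumes "open U" "holo_on U f" shows "holo_on U (euler_op f)"
  unfolding euler_op_def[abs_def]
  by (intro holo_on_sum holo_on_mult holo_on_coord holo_on_pd assms)

text \<open>The commutator of a partial derivative with the Euler field is that derivative; the
  extra term comes from differentiating the coefficient \<open>coord \<sigma> m\<close>.\<close>

lemma pd_euler_op:
  fixes f :: "complex ^ 'k \<Rightarrow> complex"
  assumes "open U" "holo_on U f" "\<sigma> \<in> U" "m \<in> {1..CARD('k)}"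
  shows "pd m (euler_op f) \<sigma> = euler_op (pd m f) \<sigma> + pd m f \<sigma>"
proof -
  have "pd m (euler_op f) \<sigma> = (\<Sum>h=1..CARD('k). pd m (\<lambda>\<tau>. coord \<tau> h * pd h f \<tau>) \<sigma>)"
    unfolding euler_op_def[abs_def]
    by (rule pd_sum[OF _ assms(3)]) (intro holo_on_mult holo_on_coord holo_on_pd assms)
  also have "\<dots> = (\<Sum>h=1..CARD('k). coord \<sigma> h * pd h (pd m f) \<sigma> + (if h = m then pd h f \<sigma> else 0))"
  proof (intro sum.cong refl)
    fix h assume h: "h \<in> {1..CARD('k)}"
    have "pd m (\<lambda>\<tau>. coord \<tau> h * pd h f \<tau>) \<sigma>
        = coord \<sigma> h * pd m (pd h f) \<sigma> + pd m (\<lambda>\<tau>. coord \<tau> h) \<sigma> * pd h f \<sigma>"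
      by (rule pd_mult[OF holo_on_coord holo_on_pd[OF assms(1,2)] assms(3)])
    then show "pd m (\<lambda>\<tau>. coord \<tau> h * pd h f \<tau>) \<sigma>
        = coord \<sigma> h * pd h (pd m f) \<sigma> + (if h = m then pd h f \<sigma> else 0)"
      using pd_commute[OF assms(1-3) h] h assms(4) by (simp add: pd_coord)
  qed
  also have "\<dots> = euler_op (pd m f) \<sigma> + pd m f \<sigma>"
    using assms(4) by (simp add: sum.distrib euler_op_def)
  finally show ?thesis .
qed

lemma pdl_euler_op:
  fixes f :: "complex ^ 'k \<Rightarrow> complex"
  assumes "open U" "holo_on U f" "\<sigma> \<in> U" "set L \<subseteq> {1..CARD('k)}"
  shows "pdl L (euler_op f) \<sigma> = euler_op (pdl L f) \<sigma> + of_nat (length L) * pdl L f \<sigma>"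
  using assms(3,4)
proof (induction L arbitrary: \<sigma>)
  case (Cons h L)
  let ?n = "of_nat (length L)" and ?g = "pdl L f"
  note g = holo_on_pdl[OF assms(1,2), of L]
  have "pdl (h # L) (euler_op f) \<sigma> = pd h (\<lambda>\<sigma>. euler_op ?g \<sigma> + ?n * ?g \<sigma>) \<sigma>"
    unfolding pdl_simps by (rule pd_cong[OF assms(1) Cons.prems(1) Cons.IH]) (use Cons.prems in auto)
  also have "\<dots> = pd h (euler_op ?g) \<sigma> + pd h (\<lambda>\<sigma>. ?n * ?g \<sigma>) \<sigma>"
    by (rule pd_add[OF holo_on_euler_op[OF assms(1) g] _ Cons.prems(1)]) (intro holo_on_mult holo_on_const g)
  also have "\<dots> = euler_op (pd h ?g) \<sigma> + pd h ?g \<sigma> + ?n * pd h ?g \<sigma>"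
    using Cons.prems by (simp add: pd_euler_op[OF assms(1) g] pd_cmult[OF g])
  finally show ?case by (simp add: algebra_simps)
qed simp

lemma T_op_eq:
  fixes f :: "complex ^ 'k \<Rightarrow> complex"
  assumes "open U" "holo_on U f" "\<sigma> \<in> U" "m \<in> {1..CARD('k)}"
  shows "T_op \<mu> m f \<sigma> = pdl [1, m - 1] f \<sigma> + (euler_op (pd m f) \<sigma> + (1 + \<mu>) * pd m f \<sigma>)"
proof -
  have "pd m (\<lambda>\<tau>. euler_op f \<tau> + \<mu> * f \<tau>) \<sigma> = pd m (euler_op f) \<sigma> + pd m (\<lambda>\<tau>. \<mu> * f \<tau>) \<sigma>"
    by (rule pd_add[OF holo_on_euler_op[OF assms(1,2)] _ assms(3)]) (intro holo_on_mult holo_on_const assms)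
  then show ?thesis unfolding T_op_def
    by (simp add: pd_euler_op[OF assms] pd_cmult[OF assms(2,3)] algebra_simps)
qed

text \<open>Once all derivatives have passed the Euler field, \<open>pdl (L @ [m])\<close> is the
  only term of order n = \<open>Suc (length L)\<close>, with coefficient \<mu> + n; every other term
  has order n + 1.\<close>

lemma pdl_T_op:
  fixes f :: "complex ^ 'k \<Rightarrow> complex"
  assumes "open U" "holo_on U f" "\<sigma> \<in> U" "m \<in> {1..CARD('k)}" "set L \<subseteq> {1..CARD('k)}"
  shows "pdl L (T_op \<mu> m f) \<sigma> = pdl (L @ [1, m - 1]) f \<sigma>
     + (\<Sum>h=1..CARD('k). coord \<sigma> h * pdl (h # L @ [m]) f \<sigma>)
     + (\<mu> + of_nat (Suc (length L))) * pdl (L @ [m]) f \<sigma>"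
proof -
  note g = holo_on_pd[OF assms(1,2), of m]
  have h1: "holo_on U (euler_op (pd m f))" by (rule holo_on_euler_op[OF assms(1) g])
  have h2: "holo_on U (\<lambda>\<sigma>. (1 + \<mu>) * pd m f \<sigma>)" by (intro holo_on_mult holo_on_const g)
  have "pdl L (T_op \<mu> m f) \<sigma> = pdl L (\<lambda>\<sigma>. pdl [1, m - 1] f \<sigma> +
      (euler_op (pd m f) \<sigma> + (1 + \<mu>) * pd m f \<sigma>)) \<sigma>"
    by (rule pdl_cong[OF assms(1,3)]) (rule T_op_eq[OF assms(1,2) _ assms(4)])
  also have "\<dots> = pdl L (pdl [1, m - 1] f) \<sigma> +
      (pdl L (euler_op (pd m f)) \<sigma> + (1 + \<mu>) * pdl L (pd m f) \<sigma>)"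
    by (simp only: pdl_add[OF assms(1) holo_on_pdl[OF assms(1,2)] holo_on_add[OF h1 h2] assms(3)]
          pdl_add[OF assms(1) h1 h2 assms(3)] pdl_cmult[OF assms(1) g assms(3)])
  also have "\<dots> = pdl (L @ [1, m - 1]) f \<sigma>
     + (\<Sum>h=1..CARD('k). coord \<sigma> h * pdl (h # L @ [m]) f \<sigma>)
     + (\<mu> + of_nat (Suc (length L))) * pdl (L @ [m]) f \<sigma>"
    by (simp add: pdl_euler_op[OF assms(1) g assms(3,5)] euler_op_def algebra_simps)
  finally show ?thesis .
qed

section \<open>Normal forms modulo the left ideal\<close>

text \<open>Letters are at least 1, so \<open>min j N\<close> is the highest order up to
  \<open>N\<close> that a derivative of weight \<open>j\<close> can have.\<close>

abbreviation nf_list :: "nat \<Rightarrow> nat \<Rightarrow> nat \<Rightarrow> nat list" where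
  "nf_list k N j \<equiv> greedy_list k (min j N) j"

lemma nf_list_props:
  assumes "k \<ge> 1" "j \<le> k * N"
  shows "length (nf_list k N j) = min j N" "sum_list (nf_list k N j) = j" "set (nf_list k N j) \<subseteq> {1..k}"
proof -
  have "j \<le> k * min j N" using assms by (auto simp: min_def)
  from greedy_list_props[OF assms(1) _ this]
  show "length (nf_list k N j) = min j N" "sum_list (nf_list k N j) = j" "set (nf_list k N j) \<subseteq> {1..k}"
    by simp_all
qed

definition has_nf :: "complex \<Rightarrow> complex ^ 'k \<Rightarrow> nat \<Rightarrow> 'k operator \<Rightarrow> bool" where
  "has_nf \<mu> x N P \<longleftrightarrow> (\<exists>c. (\<forall>j. c j \<in> holo_germs x) \<and>
     in_ideal \<mu> x (\<lambda>f \<sigma>. P f \<sigma> - (\<Sum>j\<le>CARD('k) * N. c j \<sigma> * pdl (nf_list CARD('k) N j) f \<sigma>)))"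

lemma has_nf_cong:
  assumes "has_nf \<mu> x N P" "in_ideal \<mu> x (\<lambda>f \<sigma>. Q f \<sigma> - P f \<sigma>)"
  shows "has_nf \<mu> x N Q"
proof -
  from assms(1) obtain c where c: "\<forall>j. c j \<in> holo_germs x" and
    P: "in_ideal \<mu> x (\<lambda>f \<sigma>. P f \<sigma> - (\<Sum>j\<le>CARD('a) * N. c j \<sigma> * pdl (nf_list CARD('a) N j) f \<sigma>))"
    unfolding has_nf_def by blast
  have "in_ideal \<mu> x (\<lambda>f \<sigma>. Q f \<sigma> - (\<Sum>j\<le>CARD('a) * N. c j \<sigma> * pdl (nf_list CARD('a) N j) f \<sigma>))"
    by (rule in_ideal_eqI[OF in_ideal_add[OF assms(2) P]]) simp
  with c show ?thesis unfolding has_nf_def by blast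
qed

lemma has_nf_zero: "has_nf \<mu> x N (\<lambda>f \<sigma>. 0)"
  unfolding has_nf_def
  by (intro exI[of _ "\<lambda>j \<sigma>. 0"]) (auto simp: in_ideal_zero)

lemma has_nf_add:
  assumes "has_nf \<mu> x N P" "has_nf \<mu> x N Q"
  shows "has_nf \<mu> x N (\<lambda>f \<sigma>. P f \<sigma> + Q f \<sigma>)"
proof -
  from assms(1) obtain c where c: "\<forall>j. c j \<in> holo_germs x" and
    P: "in_ideal \<mu> x (\<lambda>f \<sigma>. P f \<sigma> - (\<Sum>j\<le>CARD('a) * N. c j \<sigma> * pdl (nf_list CARD('a) N j) f \<sigma>))"
    unfolding has_nf_def by blast
  from assms(2) obtain d where d: "\<forall>j. d j \<in> holo_germs x" and
    Q: "in_ideal \<mu> x (\<lambda>f \<sigma>. Q f \<sigma> - (\<Sum>j\<le>CARD('a) * N. d j \<sigma> * pdl (nf_list CARD('a) N j) f \<sigma>))"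
    unfolding has_nf_def by blast
  have "in_ideal \<mu> x (\<lambda>f \<sigma>. (P f \<sigma> + Q f \<sigma>) -
      (\<Sum>j\<le>CARD('a) * N. (c j \<sigma> + d j \<sigma>) * pdl (nf_list CARD('a) N j) f \<sigma>))"
    by (rule in_ideal_eqI[OF in_ideal_add[OF P Q]]) (simp add: distrib_right sum.distrib)
  with c d show ?thesis unfolding has_nf_def
    by (intro exI[of _ "\<lambda>j \<sigma>. c j \<sigma> + d j \<sigma>"]) (simp add: holo_germs_add)
qed

lemma has_nf_cmult:
  assumes "has_nf \<mu> x N P" "b \<in> holo_germs x"
  shows "has_nf \<mu> x N (\<lambda>f \<sigma>. b \<sigma> * P f \<sigma>)"
proof -
  from assms(1) obtain c where c: "\<forall>j. c j \<in> holo_germs x" and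
    P: "in_ideal \<mu> x (\<lambda>f \<sigma>. P f \<sigma> - (\<Sum>j\<le>CARD('a) * N. c j \<sigma> * pdl (nf_list CARD('a) N j) f \<sigma>))"
    unfolding has_nf_def by blast
  have "in_ideal \<mu> x (\<lambda>f \<sigma>. b \<sigma> * P f \<sigma> -
      (\<Sum>j\<le>CARD('a) * N. (b \<sigma> * c j \<sigma>) * pdl (nf_list CARD('a) N j) f \<sigma>))"
    by (rule in_ideal_eqI[OF in_ideal_cmult[OF P assms(2)]])
       (simp add: right_diff_distrib sum_distrib_left mult.assoc)
  with c assms(2) show ?thesis unfolding has_nf_def
    by (intro exI[of _ "\<lambda>j \<sigma>. b \<sigma> * c j \<sigma>"]) (simp add: holo_germs_mult)
qed

lemma has_nf_sum:
  assumes "\<And>i. i \<in> I \<Longrightarrow> has_nf \<mu> x N (P i)"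
  shows "has_nf \<mu> x N (\<lambda>f \<sigma>. \<Sum>i\<in>I. P i f \<sigma>)"
  using assms
proof (induction I rule: infinite_finite_induct)
  case (insert i I)
  then have "has_nf \<mu> x N (\<lambda>f \<sigma>. P i f \<sigma> + (\<Sum>i\<in>I. P i f \<sigma>))"
    by (intro has_nf_add) simp_all
  with insert.hyps show ?case by simp
qed (simp_all add: has_nf_zero)

lemma has_nf_nf_list:
  assumes "j \<le> CARD('k) * N"
  shows "has_nf \<mu> (x :: complex ^ 'k) N (pdl (nf_list CARD('k) N j))"
proof -
  have "(\<Sum>i\<le>CARD('k) * N. (if i = j then 1 else 0) * pdl (nf_list CARD('k) N i) f \<sigma>)
      = pdl (nf_list CARD('k) N j) f \<sigma>" for f and \<sigma> :: "complex ^ 'k"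
  proof -
    have "(\<Sum>i\<le>CARD('k) * N. (if i = j then 1 else 0) * pdl (nf_list CARD('k) N i) f \<sigma>)
        = (\<Sum>i\<le>CARD('k) * N. if i = j then pdl (nf_list CARD('k) N i) f \<sigma> else 0)"
      by (intro sum.cong) auto
    with assms show ?thesis by simp
  qed
  then show ?thesis unfolding has_nf_def
    by (intro exI[of _ "\<lambda>i \<sigma>. if i = j then 1 else 0"]) (simp add: in_ideal_zero holo_germs_const)
qed

text \<open>The relation \<open>pdl_T_op\<close> expresses an operator of order \<open>n\<close> and weight \<open>j > n\<close> through
  operators of order \<open>n + 1\<close>: this is where \<open>\<mu> + n\<close> has to be invertible.\<close>

lemma has_nf_greedy_list:
  fixes x :: "complex ^ 'k"
  assumes k: "CARD('k) \<ge> 2" and \<mu>: "\<mu> \<notin> \<int>\<^sub>\<le>\<^sub>0" and "n \<le> N" "n \<le> j" "j \<le> CARD('k) * n"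
  shows "has_nf \<mu> x N (pdl (greedy_list CARD('k) n j))"
  using assms(3-)
proof (induction n arbitrary: j rule: inc_induct)
  \<comment> \<open>The induction descends from \<open>N\<close>. At order \<open>N\<close> the
    weight is at least \<open>N\<close>, so the word is a normal form already.\<close>
  case base
  then show ?case using has_nf_nf_list[of j N \<mu> x] by (simp add: min_absorb2)
next
  case (step n)
  define k where "k = CARD('k)"
  have k2: "k \<ge> 2" "k \<ge> 1" using k by (simp_all add: k_def)
  show ?case
  proof (cases "j = n")
    case True
    have "j \<le> CARD('k) * N" using step.prems step.hyps True
      by (meson le_trans less_imp_le mult_le_mono2)
    moreover have "min j N = n" using True step.hyps by simp
    ultimately show ?thesis using has_nf_nf_list[of j N \<mu> x] by simp
  next
    case False
    with step.prems have "n \<noteq> 0" by (cases n) auto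
    then obtain n' where n: "n = Suc n'" using not0_implies_Suc by blast
    \<comment> \<open>The largest letter that leaves enough weight for the other \<open>n'\<close>
      letters. As the weight exceeds the order, it is at least 2, as required for a generator
      \<open>T_op\<close>.\<close>
    define m where "m = min k (j - n')"
    define L where "L = greedy_list k n' (j - m)"
    have kn': "n' \<le> k * n'" using k2 by simp
    have j: "n' + 2 \<le> j" "j \<le> k + k * n'" using step.prems False by (auto simp: n k_def)
    have m: "2 \<le> m" "m \<le> k" using j k2 by (auto simp: m_def)
    have jm: "n' \<le> j - m" "j - m \<le> k * n'" "m \<le> j"
      using j kn' unfolding m_def min_def by (auto split: if_splits)
    note L = greedy_list_props[OF k2(2) jm(1,2), folded L_def]
    have nf: "has_nf \<mu> x N (pdl M)" if M: "length M = Suc n" "set M \<subseteq> {1..k}" for M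
    proof -
      have "has_nf \<mu> x N (pdl (greedy_list CARD('k) (Suc n) (sum_list M)))"
        using sum_list_bounds[OF M(2)] M(1) by (intro step.IH) (simp_all add: k_def)
      moreover have "pdl_equiv \<mu> x M (greedy_list CARD('k) (Suc n) (sum_list M))"
        using pdl_equiv_greedy_list[of "[]" M \<mu> x] M by (simp add: k_def)
      ultimately show ?thesis unfolding pdl_equiv_def by (rule has_nf_cong)
    qed
    \<comment> \<open>The factor that arises when the relation is solved for
      \<open>pdl (L @ [m])\<close>.\<close>
    define b where "b = - inverse (\<mu> + of_nat n)"
    have \<mu>n: "\<mu> + of_nat n \<noteq> 0"
    proof
      assume "\<mu> + of_nat n = 0"
      then have "\<mu> = - of_nat n" by (simp add: eq_neg_iff_add_eq_0)
      with \<mu> show False by (simp add: minus_of_nat_in_nonpos_Ints)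
    qed
    let ?A = "\<lambda>f \<sigma>. pdl (L @ [1, m - 1]) f \<sigma>"
      and ?B = "\<lambda>f \<sigma>. \<Sum>h=1..CARD('k). coord \<sigma> h * pdl (h # L @ [m]) f \<sigma>"
    have "has_nf \<mu> x N (\<lambda>f \<sigma>. b * (?A f \<sigma> + ?B f \<sigma>))"
      by (intro has_nf_cmult[where b = "\<lambda>_. b"] has_nf_add has_nf_sum has_nf_cmult[where b = "\<lambda>\<sigma>. coord \<sigma> _"]
            holo_germs_const holo_germs_coord nf)
         (use L m n k2 in \<open>auto simp: k_def[symmetric]\<close>)
    moreover have "in_ideal \<mu> x (\<lambda>f \<sigma>. pdl (L @ [m]) f \<sigma> - b * (?A f \<sigma> + ?B f \<sigma>))"
    proof (rule in_ideal_cong)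
      show "in_ideal \<mu> x (\<lambda>f \<sigma>. - b * pdl L (T_op \<mu> m f) \<sigma>)"
        by (rule in_ideal_cmult[where c = "\<lambda>_. - b"])
           (use L m in \<open>auto intro!: in_ideal_pdl_T simp: k_def\<close>)
      show "same_germ x (\<lambda>f \<sigma>. pdl (L @ [m]) f \<sigma> - b * (?A f \<sigma> + ?B f \<sigma>))
         (\<lambda>f \<sigma>. - b * pdl L (T_op \<mu> m f) \<sigma>)"
      proof (rule same_germI)
        fix V :: "(complex ^ 'k) set" and f \<sigma> assume V: "open V" "holo_on V f" "\<sigma> \<in> V"
        have "pdl L (T_op \<mu> m f) \<sigma> = ?A f \<sigma> + ?B f \<sigma> + (\<mu> + of_nat (Suc (length L))) * pdl (L @ [m]) f \<sigma>"
          by (rule pdl_T_op[OF V]) (use L m in \<open>auto simp: k_def\<close>)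
        also have "Suc (length L) = n" using L n by simp
        finally have T: "pdl L (T_op \<mu> m f) \<sigma>
            = ?A f \<sigma> + ?B f \<sigma> + (\<mu> + of_nat n) * pdl (L @ [m]) f \<sigma>" .
        have "- b * (\<mu> + of_nat n) = 1" using \<mu>n by (simp add: b_def)
        then have "z - b * w = - b * (w + (\<mu> + of_nat n) * z)" for w z
          by (simp only: distrib_left[of "- b"] mult.assoc[symmetric]) simp
        then show "pdl (L @ [m]) f \<sigma> - b * (?A f \<sigma> + ?B f \<sigma>) = - b * pdl L (T_op \<mu> m f) \<sigma>"
          unfolding T .
      qed
    qed
    ultimately have "has_nf \<mu> x N (pdl (L @ [m]))" by (rule has_nf_cong)
    moreover have "pdl_equiv \<mu> x (L @ [m]) (greedy_list CARD('k) n j)"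
      using pdl_equiv_greedy_list[of "[]" "L @ [m]" \<mu> x] L m n jm by (simp add: k_def)
    ultimately show ?thesis using has_nf_cong pdl_equiv_sym unfolding pdl_equiv_def by blast
  qed
qed

lemma diffop_germs_has_nf:
  fixes x :: "complex ^ 'k"
  assumes "CARD('k) \<ge> 2" "\<mu> \<notin> \<int>\<^sub>\<le>\<^sub>0" "P \<in> diffop_germs x"
  obtains N where "has_nf \<mu> x N P"
  using assms(3)
proof (rule diffop_germs_obtain_representation)
  fix A c N assume A: "finite A" "\<And>\<alpha>. \<alpha> \<in> A \<Longrightarrow> c \<alpha> \<in> holo_germs x"
    and "pdl_representation x P A c (mlist CARD('k)) N"
  then interpret pdl_representation x P A c "mlist CARD('k)" N by simp
  have "has_nf \<mu> x N (pdl L)" if L: "set L \<subseteq> {1..CARD('k)}" "length L \<le> N" for L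
  proof -
    have "has_nf \<mu> x N (pdl (greedy_list CARD('k) (length L) (sum_list L)))"
      using sum_list_bounds[OF L(1)] L(2) by (intro has_nf_greedy_list assms(1,2))
    moreover have "in_ideal \<mu> x (\<lambda>f \<sigma>. pdl L f \<sigma> - pdl (greedy_list CARD('k) (length L) (sum_list L)) f \<sigma>)"
      using pdl_equiv_greedy_list[of "[]" L \<mu> x] L(1) by (simp add: pdl_equiv_def)
    ultimately show ?thesis by (rule has_nf_cong)
  qed
  then have "has_nf \<mu> x N (\<lambda>f \<sigma>. \<Sum>\<alpha>\<in>A. c \<alpha> \<sigma> * pdl (mlist CARD('k) \<alpha>) f \<sigma>)"
    using A(2) lists by (intro has_nf_sum has_nf_cmult) simp_all
  moreover have "in_ideal \<mu> x (\<lambda>f \<sigma>. P f \<sigma> - (\<Sum>\<alpha>\<in>A. c \<alpha> \<sigma> * pdl (mlist CARD('k) \<alpha>) f \<sigma>))"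
  proof (rule in_ideal_cong)
    let ?S = "\<lambda>f \<sigma>. \<Sum>\<alpha>\<in>A. c \<alpha> \<sigma> * pdl (mlist CARD('k) \<alpha>) f \<sigma>"
    show "same_germ x (\<lambda>f \<sigma>. P f \<sigma> - ?S f \<sigma>) (\<lambda>f \<sigma>. ?S f \<sigma> - ?S f \<sigma>)"
      by (rule same_germ_diff[OF rep same_germ_refl])
    show "in_ideal \<mu> x (\<lambda>f \<sigma>. ?S f \<sigma> - ?S f \<sigma>)" by (simp add: in_ideal_zero)
  qed
  ultimately have "has_nf \<mu> x N P" by (rule has_nf_cong)
  then show thesis by (rule that)
qed

section \<open>The ideal annihilates the functions\<close>

lemma diffop_germs_zero_at:
  assumes "P \<in> diffop_germs x" "open V" "x \<in> V" "\<And>\<sigma>. \<sigma> \<in> V \<Longrightarrow> g \<sigma> = 0"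
  shows "eventually (\<lambda>\<sigma>. P g \<sigma> = 0) (nhds x)"
  using assms(1)
proof (rule diffop_germsE)
  fix A c assume "same_germ x P (\<lambda>f \<sigma>. \<Sum>\<alpha>\<in>A. c \<alpha> \<sigma> * pd_multi \<alpha> f \<sigma>)"
  then obtain U where U: "open U" "x \<in> U"
    "\<And>V f \<sigma>. open V \<Longrightarrow> V \<subseteq> U \<Longrightarrow> holo_on V f \<Longrightarrow> \<sigma> \<in> V \<Longrightarrow>
       P f \<sigma> = (\<Sum>\<alpha>\<in>A. c \<alpha> \<sigma> * pd_multi \<alpha> f \<sigma>)"
    by (rule same_germE) blast
  have UV: "open (U \<inter> V)" using U(1) assms(2) by blast
  have "P g \<sigma> = 0" if \<sigma>: "\<sigma> \<in> U \<inter> V" for \<sigma>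
  proof -
    \<comment> \<open>Nothing is known about \<open>g\<close> away from \<open>V\<close>, but it is
      holomorphic on this smaller set, so the representation of \<open>P\<close> can be applied to
      it there.\<close>
    have "holo_on (U \<inter> V) g"
      by (rule holo_on_cong[OF UV holo_on_const[of _ 0]]) (use assms(4) in blast)
    then have "P g \<sigma> = (\<Sum>\<alpha>\<in>A. c \<alpha> \<sigma> * pd_multi \<alpha> g \<sigma>)"
      by (rule U(3)[OF UV Int_lower1 _ \<sigma>])
    moreover have "pdl L g \<sigma> = 0" for L
      using pdl_cong[OF UV \<sigma>, of g "\<lambda>_. 0" L] assms(4) pdl_zero[of L \<sigma>] by simp
    ultimately show ?thesis by (simp add: pd_multi_eq_pdl)
  qed
  moreover have "eventually (\<lambda>\<sigma>. \<sigma> \<in> U \<inter> V) (nhds x)"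
    using UV U(2) assms(3) by (intro eventually_nhds_in_open) simp_all
  ultimately show ?thesis by (rule eventually_mono[rotated])
qed

lemma pdl_pair_F_fun:
  fixes \<sigma> :: "complex ^ 'k"
  assumes "h \<in> {1..CARD('k)}" "j \<in> {1..CARD('k)}" "a \<noteq> 0" "\<sigma> \<in> gen_dom (1 / a)"
  shows "pdl [h, j] (F_fun \<mu> a) \<sigma>
       = (-1) ^ (h + j) * \<mu> * (\<mu> + 1) * (1 / a) ^ (h + j) * gen (1 / a) \<sigma> powr (- \<mu> - 2)"
  using pdl_F_fun[of "[h, j]" a \<sigma> \<mu>] assms by (simp add: pd_factor_def pochhammer_Suc power_add)

text \<open>Second derivatives of \<open>F_fun \<mu> a\<close> depend only on the sum of the two
  indices, which is the same in both terms.\<close>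

lemma A_op_F_fun:
  fixes \<sigma> :: "complex ^ 'k"
  assumes "p \<in> {1..CARD('k) - 1}" "q \<in> {2..CARD('k)}" "a \<noteq> 0" "\<sigma> \<in> gen_dom (1 / a)"
  shows "A_op p q (F_fun \<mu> a) \<sigma> = 0"
proof -
  have p: "1 \<le> p" "p \<le> CARD('k) - 1" and q: "2 \<le> q" "q \<le> CARD('k)" using assms(1,2) by simp_all
  have "p \<in> {1..CARD('k)}" "q \<in> {1..CARD('k)}" "p + 1 \<in> {1..CARD('k)}" "q - 1 \<in> {1..CARD('k)}"
    unfolding atLeastAtMost_iff using p q by linarith+
  note pq = this
  have "(p + 1) + (q - 1) = p + q" using q by simp
  then have "pdl [p, q] (F_fun \<mu> a) \<sigma> = pdl [p + 1, q - 1] (F_fun \<mu> a) \<sigma>"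
    by (simp only: pdl_pair_F_fun[OF pq(1,2) assms(3,4)] pdl_pair_F_fun[OF pq(3,4) assms(3,4)])
  then show ?thesis by (simp add: A_op_def)
qed

text \<open>With e the value of the first term and u that of \<open>gen\<close>, the Euler term is e
  * (u - 1) and the first order term is - e * u.\<close>

lemma T_op_F_fun:
  fixes \<sigma> :: "complex ^ 'k"
  assumes "m \<in> {2..CARD('k)}" "a \<noteq> 0" "\<sigma> \<in> gen_dom (1 / a)"
  shows "T_op \<mu> m (F_fun \<mu> a) \<sigma> = 0"
proof -
  let ?u = "gen (1 / a) \<sigma>" and ?F = "F_fun \<mu> a" and ?s = "1 / a"
  let ?e = "(-1) ^ m * \<mu> * (\<mu> + 1) * ?s ^ m * ?u powr (- \<mu> - 2)"
  have m: "m \<in> {1..CARD('k)}" "m - 1 \<in> {1..CARD('k)}" "1 \<in> {1..CARD('k)}" "1 + (m - 1) = m"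
    using assms(1) by auto
  have u: "?u powr (- \<mu> - 1) = ?u * ?u powr (- \<mu> - 2)"
  proof -
    have "- \<mu> - 1 = 1 + (- \<mu> - 2)" by simp
    then have "?u powr (- \<mu> - 1) = ?u powr (1 + (- \<mu> - 2))" by (simp only:)
    also have "\<dots> = ?u powr 1 * ?u powr (- \<mu> - 2)" by (rule powr_add)
    also have "?u powr 1 = ?u" using powr_nat'[of ?u 1] by simp
    finally show ?thesis .
  qed
  note two = pdl_pair_F_fun[OF _ _ assms(2,3)]
  have "T_op \<mu> m ?F \<sigma> = pdl [1, m - 1] ?F \<sigma> + (euler_op (pd m ?F) \<sigma> + (1 + \<mu>) * pd m ?F \<sigma>)"
    by (rule T_op_eq[OF open_gen_dom holo_on_F_fun[OF assms(2)] assms(3) m(1)])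
  also have "pdl [1, m - 1] ?F \<sigma> = ?e"
    using two[OF m(3,2)] by (simp only: m(4))
  also have "euler_op (pd m ?F) \<sigma> = (\<Sum>h=1..CARD('k). coord \<sigma> h * pdl [h, m] ?F \<sigma>)"
    by (simp add: euler_op_def)
  also have "\<dots> = (\<Sum>h=1..CARD('k). ?e * ((-1) ^ h * coord \<sigma> h * ?s ^ h))"
    by (intro sum.cong refl) (simp only: two m(1) power_add mult_ac)
  also have "\<dots> = ?e * (?u - 1)"
    by (simp add: gen_def sum_distrib_left)
  also have "pd m ?F \<sigma> = - ((-1) ^ m) * \<mu> * ?s ^ m * (?u * ?u powr (- \<mu> - 2))"
    using pdl_F_fun[of "[m]" a \<sigma> \<mu>] m(1) assms(2,3)
    by (simp add: pd_factor_def u[symmetric])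
  also have "?e + (?e * (?u - 1) + (1 + \<mu>) * (- ((-1) ^ m) * \<mu> * ?s ^ m * (?u * ?u powr (- \<mu> - 2)))) = 0"
    by (simp add: algebra_simps)
  finally show ?thesis .
qed

text \<open>The generators annihilate the function on \<open>gen_dom (1 / a)\<close>. Each left
  coefficient then gives zero on its own neighbourhood of \<open>x\<close>, and there are finitely
  many of them.\<close>

lemma in_ideal_kills_F_fun:
  fixes x :: "complex ^ 'k"
  assumes "in_ideal \<mu> x P" "a \<noteq> 0" "x \<in> gen_dom (1 / a)"
  shows "kills x P (F_fun \<mu> a)"
proof -
  let ?F = "F_fun \<mu> a :: complex ^ 'k \<Rightarrow> complex"
  from assms(1) obtain Q R where Q: "\<forall>p\<in>{1..CARD('k) - 1}. \<forall>q\<in>{2..CARD('k)}. Q p q \<in> diffop_germs x"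
    and R: "\<forall>m\<in>{2..CARD('k)}. R m \<in> diffop_germs x" and P: "same_germ x P (left_comb \<mu> Q R)"
    by (rule in_idealE)
  from P obtain U where U: "open U" "x \<in> U"
    "\<And>V f \<sigma>. open V \<Longrightarrow> V \<subseteq> U \<Longrightarrow> holo_on V f \<Longrightarrow> \<sigma> \<in> V \<Longrightarrow> P f \<sigma> = left_comb \<mu> Q R f \<sigma>"
    by (rule same_germE) blast
  have 1: "eventually (\<lambda>\<sigma>. \<forall>p\<in>{1..CARD('k) - 1}. \<forall>q\<in>{2..CARD('k)}. Q p q (A_op p q ?F) \<sigma> = 0) (nhds x)"
    by (intro eventually_ball_finite ballI finite_atLeastAtMost
          diffop_germs_zero_at[OF _ open_gen_dom assms(3)] A_op_F_fun[OF _ _ assms(2)])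
       (use Q in auto)
  have 2: "eventually (\<lambda>\<sigma>. \<forall>m\<in>{2..CARD('k)}. R m (T_op \<mu> m ?F) \<sigma> = 0) (nhds x)"
    by (intro eventually_ball_finite ballI finite_atLeastAtMost
          diffop_germs_zero_at[OF _ open_gen_dom assms(3)] T_op_F_fun[OF _ assms(2)])
       (use R in auto)
  have "open (U \<inter> gen_dom (1 / a))" using U(1) open_gen_dom by blast
  then have 3: "eventually (\<lambda>\<sigma>. \<sigma> \<in> U \<inter> gen_dom (1 / a)) (nhds x)"
    using U(2) assms(3) by (intro eventually_nhds_in_open) simp_all
  show ?thesis unfolding kills_def
    using 1 2 3
  proof eventually_elim
    case (elim \<sigma>)
    have "P ?F \<sigma> = left_comb \<mu> Q R ?F \<sigma>"
      by (rule U(3)[OF \<open>open (U \<inter> gen_dom (1 / a))\<close> Int_lower1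
            holo_on_subset[OF holo_on_F_fun[OF assms(2)] Int_lower2] elim(3)])
    with elim(1,2) show ?case by (simp add: left_comb_def)
  qed
qed

lemma in_ideal_kills_all_F_fun:
  assumes "in_ideal \<mu> x P"
  shows "\<exists>r. \<forall>a. cmod a > r \<longrightarrow> kills x P (F_fun \<mu> a)"
proof -
  obtain r where r: "r > 0 \<and> (\<forall>a. cmod a > r \<longrightarrow> x \<in> gen_dom (1 / a))"
    using eventually_mem_gen_dom[of x] by (rule exE)
  have "kills x P (F_fun \<mu> a)" if "cmod a > r" for a
    by (rule in_ideal_kills_F_fun[OF assms]) (use r that in auto)
  then show ?thesis by blast
qed

lemma ideal_germs_subset_ann_F: "ideal_germs \<mu> x \<subseteq> ann_F \<mu> x"
  unfolding ideal_germs_eq ann_F_def using in_ideal_kills_all_F_fun by blast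

section \<open>Triangularity and the reverse inclusion\<close>

lemma sum_monom_mult_eq_0:
  fixes b :: "nat \<Rightarrow> 'b::comm_ring_1"
  assumes "(\<Sum>j\<le>M. monom (b j) j * V j) = 0" "j \<le> M" "\<And>j. coeff (V j) 0 = 1"
  shows "b j = 0"
  using assms(2)
proof (induction j rule: less_induct)
  case (less j)
  have "0 = coeff (\<Sum>j\<le>M. monom (b j) j * V j) j" by (simp add: assms(1))
  also have "\<dots> = (\<Sum>i\<le>M. if j < i then 0 else b i * coeff (V i) (j - i))"
    by (simp add: coeff_sum coeff_monom_mult)
  \<comment> \<open>Terms with \<open>i < j\<close> vanish by induction, those with
    \<open>i > j\<close> by their order in the variable, and the diagonal coefficient is 1.\<close>
  also have "\<dots> = (\<Sum>i\<le>M. if i = j then b j else 0)"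
    using less by (intro sum.cong refl) (auto simp: assms(3) not_less)
  also have "\<dots> = b j" using less.prems by simp
  finally show ?case by simp
qed

lemma pochhammer_neq_0:
  assumes "(\<mu> :: complex) \<notin> \<int>\<^sub>\<le>\<^sub>0" shows "pochhammer \<mu> n \<noteq> 0"
  using assms by (auto simp: pochhammer_eq_0_iff)

text \<open>The difference between \<open>P\<close> and its normal form \<open>S\<close> lies in the
  ideal and kills the functions, so \<open>S\<close> kills them too; its coefficients must then
  vanish near \<open>x\<close>.\<close>

lemma ann_F_subset_ideal_germs:
  fixes x :: "complex ^ 'k"
  assumes "CARD('k) \<ge> 2" "\<mu> \<notin> \<int>\<^sub>\<le>\<^sub>0"
  shows "ann_F \<mu> x \<subseteq> ideal_germs \<mu> x"
proof
  fix P assume "P \<in> ann_F \<mu> x"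
  then have P: "P \<in> diffop_germs x" and "\<exists>r. \<forall>a. cmod a > r \<longrightarrow> kills x P (F_fun \<mu> a)"
    by (simp_all add: ann_F_def)
  then obtain r where r: "\<And>a. cmod a > r \<Longrightarrow> kills x P (F_fun \<mu> a)" by blast
  define k where "k = CARD('k)"
  have k: "k \<ge> 1" using assms(1) by (simp add: k_def)
  obtain N where "has_nf \<mu> x N P" using assms P by (rule diffop_germs_has_nf)
  then obtain c where c: "\<forall>j. c j \<in> holo_germs x" and
    PS: "in_ideal \<mu> x (\<lambda>f \<sigma>. P f \<sigma> - (\<Sum>j\<le>k * N. c j \<sigma> * pdl (nf_list k N j) f \<sigma>))"
    unfolding has_nf_def k_def by blast
  define S where "S = (\<lambda>f \<sigma>. \<Sum>j\<le>k * N. c j \<sigma> * pdl (nf_list k N j) f \<sigma>)"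
  interpret pdl_representation x S "{..k * N}" c "nf_list k N" N
    by unfold_locales (use nf_list_props[OF k, of _ N] in \<open>auto simp: S_def same_germ_refl k_def\<close>)
  obtain r' where r': "\<And>a. cmod a > r' \<Longrightarrow> kills x (\<lambda>f \<sigma>. P f \<sigma> - S f \<sigma>) (F_fun \<mu> a)"
    using in_ideal_kills_all_F_fun[OF PS] unfolding S_def by blast
  have "kills x S (F_fun \<mu> a)" if a: "cmod a > max r r'" for a
  proof -
    have "kills x P (F_fun \<mu> a)" "kills x (\<lambda>f \<sigma>. P f \<sigma> - S f \<sigma>) (F_fun \<mu> a)"
      using a r r' by auto
    then show ?thesis unfolding kills_def by eventually_elim simp
  qed
  then have "eventually (\<lambda>\<sigma>. op_symbol \<mu> N {..k * N} c (nf_list k N) \<sigma> = 0) (nhds x)"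
    using kills_all_F_fun_iff[of \<mu>] by blast
  then have "eventually (\<lambda>\<sigma>. \<forall>j\<le>k * N. c j \<sigma> = 0) (nhds x)"
  proof (rule eventually_mono)
    fix \<sigma> assume 0: "op_symbol \<mu> N {..k * N} c (nf_list k N) \<sigma> = 0"
    \<comment> \<open>Each weight occurs once and \<open>upoly\<close> has constant term 1, so the
      symbol is a triangular combination.\<close>
    have "(\<Sum>j\<le>k * N. monom (c j \<sigma> * pd_factor \<mu> (min j N) j) j * upoly \<sigma> ^ (N - min j N))
        = op_symbol \<mu> N {..k * N} c (nf_list k N) \<sigma>"
      unfolding op_symbol_def by (intro sum.cong refl) (simp add: nf_list_props[OF k])
    also note 0
    finally have "c j \<sigma> * pd_factor \<mu> (min j N) j = 0" if "j \<le> k * N" for j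
      using that by (rule sum_monom_mult_eq_0[where V = "\<lambda>j. upoly \<sigma> ^ (N - min j N)"
            and b = "\<lambda>j. c j \<sigma> * pd_factor \<mu> (min j N) j"]) (simp add: coeff_0_power coeff_upoly_0)
    then show "\<forall>j\<le>k * N. c j \<sigma> = 0"
      using pochhammer_neq_0[OF assms(2)] by (simp add: pd_factor_def)
  qed
  then obtain U where U: "open U" "x \<in> U" "\<forall>\<sigma>\<in>U. \<forall>j\<le>k * N. c j \<sigma> = 0"
    unfolding eventually_nhds by blast
  \<comment> \<open>The coefficients of \<open>S\<close> are zero on \<open>U\<close>, so
    subtracting \<open>S\<close> does not change the germ.\<close>
  have "same_germ x P (\<lambda>f \<sigma>. P f \<sigma> - S f \<sigma>)"
    unfolding same_germ_def
    by (rule exI[of _ U]) (use U in \<open>auto simp: S_def subset_iff\<close>)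
  with PS have "in_ideal \<mu> x P" unfolding S_def by (rule in_ideal_cong)
  with P show "P \<in> ideal_germs \<mu> x" by (simp add: ideal_germs_eq)
qed

text \<open>The equality with the ideal rests on dividing by the numbers \<mu> + n and by the
  Pochhammer constants of the symbols, all nonzero outside the nonpositive integers. The inclusion
  and the equality of the two annihilators involve no such division.\<close>

theorem proposition2p2p2:
  fixes \<mu> :: complex and x :: "complex ^ 'k"
  assumes "CARD('k) \<ge> 2" and "\<mu> \<noteq> 0"
  shows "(\<mu> \<notin> \<int>\<^sub>\<le>\<^sub>0 \<longrightarrow> ideal_germs \<mu> x = ann_F \<mu> x \<and> ideal_germs \<mu> x = ann_Phi \<mu> x)
       \<and> ideal_germs \<mu> x \<subseteq> ann_F \<mu> x \<and> ann_F \<mu> x = ann_Phi \<mu> x"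
  using ann_F_subset_ideal_germs[OF assms(1), of \<mu> x] ideal_germs_subset_ann_F[of \<mu> x]
    ann_F_eq_ann_Phi[of \<mu> x] by auto

end
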